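(* Let $\rho,\sigma$ be gauges and let $(x_n)_n,(y_n)_n:{}^{\sigma}\widetilde{\mathbb N}\to{}^{\rho}\widetilde{\mathbb R}$ be hypersequences. Then: (i) There exists at most one limit superior and at most one limit inferior of $(x_n)_n$; they are denoted $\limsup x_n$ and $\liminf x_n$. (ii) If $\alpha_m:=\sup\{x_n\mid n\in{}^{\sigma}\widetilde{\mathbb N}_{\ge m}\}$ exists for all $m\in{}^{\sigma}\widetilde{\mathbb N}$, then $\limsup x_n$ exists if and only if $\inf\{\alpha_m\mid m\in{}^{\sigma}\widetilde{\mathbb N}\}$ exists, and in that case the hyperlimit of $(\alpha_m)_m$ exists and $\limsup x_n=\text{hyperlimit of }(\alpha_m)_m=\inf\{\alpha_m\mid m\in{}^{\sigma}\widetilde{\mathbb N}\}$. (iii) $\limsup(-x_n)=-\liminf x_n$, in the sense that if one of them exists, then so does the other and they are equal. (iv) The hyperlimit of $(x_n)_n$ exists if and only if $\limsup x_n$ and $\liminf x_n$ both exist and are equal. (v) If $\limsup x_n$, $\limsup y_n$ and $\limsup(x_n+y_n)$ exist, then $\limsup(x_n+y_n)\le\limsup x_n+\limsup y_n$. In particular, if $\forall N\in{}^{\sigma}\widetilde{\mathbb N}\,\forall\bar n,\hat n\ge N\,\exists n\ge N:\ x_{\bar n}+y_{\hat n}\le x_n+y_n$, then the existence of $\limsup x_n$ and $\limsup y_n$ implies the existence of $\limsup(x_n+y_n)$. (vi) If $x_n,y_n\ge0$ for all $n\in{}^{\sigma}\widetilde{\mathbb N}$ and $\limsup x_n$, $\limsup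 y_n$ and $\limsup(x_n\cdot y_n)$ exist, then $\limsup(x_n\cdot y_n)\le\limsup x_n\cdot\limsup y_n$. In particular (still with $x_n,y_n\ge0$), if $\forall N\in{}^{\sigma}\widetilde{\mathbb N}\,\forall\bar n,\hat n\ge N\,\exists n\ge N:\ x_{\bar n}\cdot y_{\hat n}\le x_n\cdot y_n$, then the existence of $\limsup x_n$ and $\limsup y_n$ implies the existence of $\limsup(x_n\cdot y_n)$. (vii) If $\limsup x_n=:\iota$ exists, then there exists a sequence $(\bar n_q)_{q\in\mathbb N}$ of elements of ${}^{\sigma}\widetilde{\mathbb N}$ such that (a) $\bar n_{q+1}>\bar n_q$ for all $q\in\mathbb N$; (b) $\lim_{q\to+\infty}\bar n_q=+\infty$ in ${}^{\sigma}\widetilde{\mathbb R}$; (c) $\lim_{q\to+\infty}x_{\bar n_q}$ exists and equals $\iota$. (viii) Let $\iota\in{}^{\rho}\widetilde{\mathbb R}$ and let $(\bar n_q)_{q\in\mathbb N}$ be a sequence of elements of ${}^{\sigma}\widetilde{\mathbb N}$ satisfying conditions (a), (b), (c) of (vii) and such that $\forall n\in{}^{\sigma}\widetilde{\mathbb N}\,\exists p\in\mathbb N:\ \bar n_p\ge n,\ x_n\le x_{\bar n_p}$. Then $\limsup x_n$ exists and equals $\iota$.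
   Context: Let $I=(0,1]$. A gauge is a net $\rho=(\rho_\varepsilon)_{\varepsilon\in I}\in(0,1]^I$ with $\rho_\varepsilon\to0$ as $\varepsilon\to0^+$. "$\forall^0\varepsilon:\ P(\varepsilon)$" means: there is $\varepsilon_0\in I$ such that $P(\varepsilon)$ holds for all $\varepsilon\in(0,\varepsilon_0]$. $\mathbb R_\rho$ is the ring of $\rho$-moderate nets: $(x_\varepsilon)\in\mathbb R^I$ with $\exists N\in\mathbb N\,\forall^0\varepsilon:\ |x_\varepsilon|\le\rho_\varepsilon^{-N}$. Write $(x_\varepsilon)\sim_\rho(y_\varepsilon)$ if $\forall n\in\mathbb N\,\forall^0\varepsilon:\ |x_\varepsilon-y_\varepsilon|\le\rho_\varepsilon^n$; a net is $\rho$-negligible if it is $\sim_\rho 0$. ${}^{\rho}\widetilde{\mathbb R}:=\mathbb R_\rho/\sim_\rho$ (a ring with pointwise operations); classes are denoted $[x_\varepsilon]$. Order: $[x_\varepsilon]\le[y_\varepsilon]$ iff there is a $\rho$-negligible $(z_\varepsilon)$ with $\forall^0\varepsilon:\ x_\varepsilon\le y_\varepsilon+z_\varepsilon$; $x<y$ means $x\le y$ and $y-x$ is invertible. $|[x_\varepsilon]|:=[|x_\varepsilon|]$, and $\mathrm d\rho:=[\rho_\varepsilon]$. The sharp topology on ${}^{\rho}\widetilde{\mathbb R}$ has as base the balls $B_r(x)=\{y\mid |y-x|<r\}$, $r>0$. Limits of ordinary sequences (indexed by $\mathbb N$) are taken in the sharp topology; $\lim_{q\to+\infty}\bar n_q=+\infty$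 in ${}^{\sigma}\widetilde{\mathbb R}$ means $\forall p\in\mathbb N\,\exists Q\in\mathbb N\,\forall q\ge Q:\ \bar n_q>\mathrm d\sigma^{-p}$, where $\mathrm d\sigma=[\sigma_\varepsilon]$. Sharp supremum: $s^*=\sup(S)$ means that $s^*$ is an upper bound of $S\subseteq{}^{\rho}\widetilde{\mathbb R}$ belonging to the closure of $S$ in the sharp topology (equivalently, an upper bound with $\forall q\in\mathbb N\,\exists\bar s\in S:\ s^*-\mathrm d\rho^q\le\bar s$). Sharp infimum: $\inf(S)$ is a lower bound of $S$ belonging to the sharp closure of $S$. These are not the order-theoretic least upper/greatest lower bounds. Given a gauge $\sigma$, ${}^{\sigma}\widetilde{\mathbb N}:=\{[n_\varepsilon]\in{}^{\sigma}\widetilde{\mathbb R}\mid n_\varepsilon\in\mathbb N\ \forall\varepsilon\}$, ordered by the order of ${}^{\sigma}\widetilde{\mathbb R}$, and ${}^{\sigma}\widetilde{\mathbb N}_{\ge m}:=\{n\in{}^{\sigma}\widetilde{\mathbb N}\mid n\ge m\}$. A hypersequence is a map $x:{}^{\sigma}\widetilde{\mathbb N}\to{}^{\rho}\widetilde{\mathbb R}$, $x_n:=x(n)$. An element $l\in{}^{\rho}\widetilde{\mathbb R}$ is the hyperlimit of $(x_n)_n$ if $\forall q\in\mathbb N\,\exists M\in{}^{\sigma}\widetilde{\mathbb N}\,\forall n\in{}^{\sigma}\widetilde{\mathbb N}_{\ge M}:\ |x_n-l|<\mathrm d\rho^q$. Limit superior: $\iota\in{}^{\rho}\widetilde{\mathbb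 R}$ is the limit superior of $(x_n)_n$ if $\forall q\in\mathbb N\,\exists N\in{}^{\sigma}\widetilde{\mathbb N}\,\forall n\ge N:\ x_n\le\iota+\mathrm d\rho^q$, and $\forall q\in\mathbb N\,\forall N\in{}^{\sigma}\widetilde{\mathbb N}\,\exists\bar n\ge N:\ \iota-\mathrm d\rho^q\le x_{\bar n}$. Limit inferior: $\tau\in{}^{\rho}\widetilde{\mathbb R}$ is the limit inferior of $(x_n)_n$ if $\forall q\in\mathbb N\,\exists N\in{}^{\sigma}\widetilde{\mathbb N}\,\forall n\ge N:\ x_n\ge\tau-\mathrm d\rho^q$, and $\forall q\in\mathbb N\,\forall N\in{}^{\sigma}\widetilde{\mathbb N}\,\exists\bar n\ge N:\ \tau+\mathrm d\rho^q\ge x_{\bar n}$. (Indices $n,\bar n$ range over ${}^{\sigma}\widetilde{\mathbb N}$.) *)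

theory Defs
  imports "HOL-Analysis.Analysis" "HOL-Algebra.QuotRing"
begin

text \<open>
  A net \<open>(x\<^sub>\<epsilon>)\<close> over \<open>I = (0,1]\<close> is rendered as a function \<open>real \<Rightarrow> real\<close> of which only the
  values on \<open>{0<..1}\<close> matter: all conditions below are imposed on \<open>{0<..1}\<close> or only for
  all small positive \<open>\<epsilon>\<close>. The quantifier \<open>\<forall>\<^sup>0\<epsilon>\<close> is \<open>\<forall>\<^sub>F \<epsilon> in at_right 0\<close>. Since the quotient
  identifies nets that agree near \<open>0\<close>, values outside \<open>(0,1]\<close> are irrelevant.
\<close>

type_synonym net = "real \<Rightarrow> real"

definition gauge_net :: "net \<Rightarrow> bool" where
  "gauge_net \<rho> \<longleftrightarrow> (\<forall>\<epsilon>\<in>{0<..1}. 0 < \<rho> \<epsilon> \<and> \<rho> \<epsilon> \<le> 1) \<and> (\<rho> \<longlongrightarrow> 0) (at_right 0)"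

definition moderate :: "net \<Rightarrow> net set" where
  "moderate \<rho> = {x. \<exists>N::nat. \<forall>\<^sub>F \<epsilon> in at_right 0. \<bar>x \<epsilon>\<bar> \<le> \<rho> \<epsilon> powi (- int N)}"

definition negligible_nets :: "net \<Rightarrow> net set" where
  "negligible_nets \<rho> = {x. \<forall>n::nat. \<forall>\<^sub>F \<epsilon> in at_right 0. \<bar>x \<epsilon>\<bar> \<le> \<rho> \<epsilon> ^ n}"

definition moderate_ring :: "net \<Rightarrow> net ring" where
  "moderate_ring \<rho> =
    \<lparr>carrier = moderate \<rho>,
     mult = (\<lambda>x y \<epsilon>. x \<epsilon> * y \<epsilon>), one = (\<lambda>\<epsilon>. 1),
     zero = (\<lambda>\<epsilon>. 0), add = (\<lambda>x y \<epsilon>. x \<epsilon> + y \<epsilon>)\<rparr>"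

text \<open>
  Generalized numbers are the cosets of the ideal of negligible nets; two moderate nets lie
  in the same coset iff their difference is negligible.
\<close>

type_synonym gnum = "net set"

definition RC :: "net \<Rightarrow> gnum ring" where
  "RC \<rho> = moderate_ring \<rho> Quot negligible_nets \<rho>"

definition rc_class :: "net \<Rightarrow> net \<Rightarrow> gnum" where
  "rc_class \<rho> x = negligible_nets \<rho> +>\<^bsub>moderate_ring \<rho>\<^esub> x"

definition rc_le :: "net \<Rightarrow> gnum \<Rightarrow> gnum \<Rightarrow> bool" where
  "rc_le \<rho> X Y \<longleftrightarrow>
    (\<exists>x\<in>moderate \<rho>. \<exists>y\<in>moderate \<rho>. X = rc_class \<rho> x \<and> Y = rc_class \<rho> y \<and>
      (\<exists>z\<in>negligible_nets \<rho>. \<forall>\<^sub>F \<epsilon> in at_right 0. x \<epsilon> \<le> y \<epsilon> + z \<epsilon>))"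

text \<open>This is stronger than \<open>\<le>\<close> together with \<open>\<noteq>\<close>.\<close>

definition rc_less :: "net \<Rightarrow> gnum \<Rightarrow> gnum \<Rightarrow> bool" where
  "rc_less \<rho> X Y \<longleftrightarrow> rc_le \<rho> X Y \<and> Y \<ominus>\<^bsub>RC \<rho>\<^esub> X \<in> Units (RC \<rho>)"

text \<open>The union is over representatives that all yield the same class.\<close>

definition rc_abs :: "net \<Rightarrow> gnum \<Rightarrow> gnum" where
  "rc_abs \<rho> X = (\<Union>x\<in>X. rc_class \<rho> (\<lambda>\<epsilon>. \<bar>x \<epsilon>\<bar>))"

definition rc_d :: "net \<Rightarrow> gnum" where
  "rc_d \<rho> = rc_class \<rho> \<rho>"

definition sharp_ball :: "net \<Rightarrow> gnum \<Rightarrow> gnum \<Rightarrow> gnum set" where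
  "sharp_ball \<rho> r X = {Y \<in> carrier (RC \<rho>). rc_less \<rho> (rc_abs \<rho> (Y \<ominus>\<^bsub>RC \<rho>\<^esub> X)) r}"

text \<open>
  The balls form a base: finite intersections of balls are unions of balls, so generating
  from them as a subbase adds nothing.
\<close>

definition sharp_topology :: "net \<Rightarrow> gnum topology" where
  "sharp_topology \<rho> = topology_generated_by
    {sharp_ball \<rho> r X | r X.
      r \<in> carrier (RC \<rho>) \<and> X \<in> carrier (RC \<rho>) \<and> rc_less \<rho> \<zero>\<^bsub>RC \<rho>\<^esub> r}"

text \<open>Sharp suprema and infima are not the order-theoretic ones.\<close>

definition is_sharp_sup :: "net \<Rightarrow> gnum set \<Rightarrow> gnum \<Rightarrow> bool" where
  "is_sharp_sup \<rho> S s \<longleftrightarrow>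
    s \<in> carrier (RC \<rho>) \<and> (\<forall>a\<in>S. rc_le \<rho> a s) \<and> s \<in> sharp_topology \<rho> closure_of S"

definition is_sharp_inf :: "net \<Rightarrow> gnum set \<Rightarrow> gnum \<Rightarrow> bool" where
  "is_sharp_inf \<rho> S s \<longleftrightarrow>
    s \<in> carrier (RC \<rho>) \<and> (\<forall>a\<in>S. rc_le \<rho> s a) \<and> s \<in> sharp_topology \<rho> closure_of S"

definition hypernat :: "net \<Rightarrow> gnum set" where
  "hypernat \<sigma> = {rc_class \<sigma> n | n. n \<in> moderate \<sigma> \<and> (\<forall>\<epsilon>\<in>{0<..1}. n \<epsilon> \<in> \<nat>)}"

definition hypernat_ge :: "net \<Rightarrow> gnum \<Rightarrow> gnum set" where
  "hypernat_ge \<sigma> m = {n \<in> hypernat \<sigma>. rc_le \<sigma> m n}"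

text \<open>
  A hypersequence is a function \<open>gnum \<Rightarrow> gnum\<close>; only its values on \<open>hypernat \<sigma>\<close> matter.
\<close>

definition hyperseqs :: "net \<Rightarrow> net \<Rightarrow> (gnum \<Rightarrow> gnum) set" where
  "hyperseqs \<sigma> \<rho> = hypernat \<sigma> \<rightarrow> carrier (RC \<rho>)"

definition is_hyperlim :: "net \<Rightarrow> net \<Rightarrow> (gnum \<Rightarrow> gnum) \<Rightarrow> gnum \<Rightarrow> bool" where
  "is_hyperlim \<sigma> \<rho> x l \<longleftrightarrow> l \<in> carrier (RC \<rho>) \<and>
    (\<forall>q::nat. \<exists>M\<in>hypernat \<sigma>. \<forall>n\<in>hypernat_ge \<sigma> M.
      rc_less \<rho> (rc_abs \<rho> (x n \<ominus>\<^bsub>RC \<rho>\<^esub> l)) (rc_d \<rho> [^]\<^bsub>RC \<rho>\<^esub> q))"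

definition is_limsup :: "net \<Rightarrow> net \<Rightarrow> (gnum \<Rightarrow> gnum) \<Rightarrow> gnum \<Rightarrow> bool" where
  "is_limsup \<sigma> \<rho> x \<iota> \<longleftrightarrow> \<iota> \<in> carrier (RC \<rho>) \<and>
    (\<forall>q::nat. \<exists>N\<in>hypernat \<sigma>. \<forall>n\<in>hypernat_ge \<sigma> N.
      rc_le \<rho> (x n) (\<iota> \<oplus>\<^bsub>RC \<rho>\<^esub> rc_d \<rho> [^]\<^bsub>RC \<rho>\<^esub> q)) \<and>
    (\<forall>q::nat. \<forall>N\<in>hypernat \<sigma>. \<exists>n\<in>hypernat_ge \<sigma> N.
      rc_le \<rho> (\<iota> \<ominus>\<^bsub>RC \<rho>\<^esub> rc_d \<rho> [^]\<^bsub>RC \<rho>\<^esub> q) (x n))"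

definition is_liminf :: "net \<Rightarrow> net \<Rightarrow> (gnum \<Rightarrow> gnum) \<Rightarrow> gnum \<Rightarrow> bool" where
  "is_liminf \<sigma> \<rho> x \<tau> \<longleftrightarrow> \<tau> \<in> carrier (RC \<rho>) \<and>
    (\<forall>q::nat. \<exists>N\<in>hypernat \<sigma>. \<forall>n\<in>hypernat_ge \<sigma> N.
      rc_le \<rho> (\<tau> \<ominus>\<^bsub>RC \<rho>\<^esub> rc_d \<rho> [^]\<^bsub>RC \<rho>\<^esub> q) (x n)) \<and>
    (\<forall>q::nat. \<forall>N\<in>hypernat \<sigma>. \<exists>n\<in>hypernat_ge \<sigma> N.
      rc_le \<rho> (x n) (\<tau> \<oplus>\<^bsub>RC \<rho>\<^esub> rc_d \<rho> [^]\<^bsub>RC \<rho>\<^esub> q))"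

definition tends_to_infinity :: "net \<Rightarrow> (nat \<Rightarrow> gnum) \<Rightarrow> bool" where
  "tends_to_infinity \<sigma> k \<longleftrightarrow>
    (\<forall>p::nat. \<exists>Q::nat. \<forall>q\<ge>Q.
      rc_less \<sigma> (inv\<^bsub>RC \<sigma>\<^esub> (rc_d \<sigma> [^]\<^bsub>RC \<sigma>\<^esub> p)) (k q))"

text \<open>
  The following facts confirm that the quotient is well formed, that its elements are the
  classes of moderate nets modulo negligible ones, and that \<open>rc_abs\<close> acts on representatives.
\<close>

lemma gauge_netD:
  assumes "gauge_net \<rho>"
  shows "\<forall>\<^sub>F \<epsilon> in at_right 0. 0 < \<rho> \<epsilon> \<and> \<rho> \<epsilon> \<le> 1/2"
proof -
  have 1: "\<forall>\<^sub>F \<epsilon> in at_right (0::real). 0 < \<rho> \<epsilon>"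
    using assms unfolding gauge_net_def eventually_at_right_field
    by (intro exI[of _ 1]) auto
  have "(\<rho> \<longlongrightarrow> 0) (at_right 0)" using assms by (simp add: gauge_net_def)
  then have "\<forall>\<^sub>F \<epsilon> in at_right (0::real). \<rho> \<epsilon> < 1/2"
    by (rule order_tendstoD) simp
  with 1 show ?thesis by eventually_elim auto
qed

lemma moderate_add:
  assumes g: "gauge_net \<rho>" and "x \<in> moderate \<rho>" "y \<in> moderate \<rho>"
  shows "(\<lambda>\<epsilon>. x \<epsilon> + y \<epsilon>) \<in> moderate \<rho>"
proof -
  obtain N M where N: "\<forall>\<^sub>F \<epsilon> in at_right 0. \<bar>x \<epsilon>\<bar> \<le> \<rho> \<epsilon> powi (- int N)"
    and M: "\<forall>\<^sub>F \<epsilon> in at_right 0. \<bar>y \<epsilon>\<bar> \<le> \<rho> \<epsilon> powi (- int M)"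
    using assms by (auto simp: moderate_def)
  have "\<forall>\<^sub>F \<epsilon> in at_right 0. \<bar>x \<epsilon> + y \<epsilon>\<bar> \<le> \<rho> \<epsilon> powi (- int (Suc (N + M)))"
    using gauge_netD[OF g] N M
  proof eventually_elim
    case (elim \<epsilon>)
    define t where "t = inverse (\<rho> \<epsilon>)"
    have t: "t \<ge> 2" using elim by (simp add: t_def field_simps)
    have *: "\<rho> \<epsilon> powi (- int K) = t ^ K" for K
      by (simp add: t_def power_int_minus power_inverse)
    have "t ^ N \<le> t ^ (N+M)" "t ^ M \<le> t ^ (N+M)" using t by (auto intro!: power_increasing)
    then have "\<bar>x \<epsilon> + y \<epsilon>\<bar> \<le> 2 * t ^ (N+M)" using elim unfolding * by linarith
    also have "\<dots> \<le> t ^ Suc (N+M)" using t by (simp add: mult_right_mono)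
    finally show ?case unfolding * .
  qed
  then show ?thesis unfolding moderate_def by blast
qed

lemma moderate_mult:
  assumes g: "gauge_net \<rho>" and "x \<in> moderate \<rho>" "y \<in> moderate \<rho>"
  shows "(\<lambda>\<epsilon>. x \<epsilon> * y \<epsilon>) \<in> moderate \<rho>"
proof -
  obtain N M where N: "\<forall>\<^sub>F \<epsilon> in at_right 0. \<bar>x \<epsilon>\<bar> \<le> \<rho> \<epsilon> powi (- int N)"
    and M: "\<forall>\<^sub>F \<epsilon> in at_right 0. \<bar>y \<epsilon>\<bar> \<le> \<rho> \<epsilon> powi (- int M)"
    using assms by (auto simp: moderate_def)
  have "\<forall>\<^sub>F \<epsilon> in at_right 0. \<bar>x \<epsilon> * y \<epsilon>\<bar> \<le> \<rho> \<epsilon> powi (- int (N + M))"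
    using gauge_netD[OF g] N M
  proof eventually_elim
    case (elim \<epsilon>)
    have *: "\<rho> \<epsilon> powi (- int K) = inverse (\<rho> \<epsilon>) ^ K" for K
      by (simp add: power_int_minus power_inverse)
    show ?case using elim unfolding * power_add abs_mult
      by (intro mult_mono) auto
  qed
  then show ?thesis unfolding moderate_def by blast
qed

lemma negligible_add:
  assumes g: "gauge_net \<rho>" and x: "x \<in> negligible_nets \<rho>" and y: "y \<in> negligible_nets \<rho>"
  shows "(\<lambda>\<epsilon>. x \<epsilon> + y \<epsilon>) \<in> negligible_nets \<rho>"
  unfolding negligible_nets_def
proof (clarify)
  fix n
  have "\<forall>\<^sub>F \<epsilon> in at_right 0. \<bar>x \<epsilon>\<bar> \<le> \<rho> \<epsilon> ^ Suc n" "\<forall>\<^sub>F \<epsilon> in at_right 0. \<bar>y \<epsilon>\<bar> \<le> \<rho> \<epsilon> ^ Suc n"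
    using x y by (auto simp: negligible_nets_def simp del: power_Suc)
  with gauge_netD[OF g] show "\<forall>\<^sub>F \<epsilon> in at_right 0. \<bar>x \<epsilon> + y \<epsilon>\<bar> \<le> \<rho> \<epsilon> ^ n"
  proof eventually_elim
    case (elim \<epsilon>)
    have "\<rho> \<epsilon> ^ Suc n \<le> (1/2) * \<rho> \<epsilon> ^ n" using elim by (simp add: mult_right_mono)
    then show ?case using elim by linarith
  qed
qed

lemma negligible_mult:
  assumes g: "gauge_net \<rho>" and x: "x \<in> negligible_nets \<rho>" and y: "y \<in> moderate \<rho>"
  shows "(\<lambda>\<epsilon>. x \<epsilon> * y \<epsilon>) \<in> negligible_nets \<rho>"
  unfolding negligible_nets_def
proof (clarify)
  fix n
  obtain M where M: "\<forall>\<^sub>F \<epsilon> in at_right 0. \<bar>y \<epsilon>\<bar> \<le> \<rho> \<epsilon> powi (- int M)"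
    using y by (auto simp: moderate_def)
  have "\<forall>\<^sub>F \<epsilon> in at_right 0. \<bar>x \<epsilon>\<bar> \<le> \<rho> \<epsilon> ^ (n + M)"
    using x by (auto simp: negligible_nets_def)
  with gauge_netD[OF g] M show "\<forall>\<^sub>F \<epsilon> in at_right 0. \<bar>x \<epsilon> * y \<epsilon>\<bar> \<le> \<rho> \<epsilon> ^ n"
  proof eventually_elim
    case (elim \<epsilon>)
    have "\<bar>x \<epsilon> * y \<epsilon>\<bar> \<le> \<rho> \<epsilon> ^ (n + M) * \<rho> \<epsilon> powi (- int M)"
      using elim unfolding abs_mult by (intro mult_mono) auto
    also have "\<dots> = \<rho> \<epsilon> ^ n" using elim by (simp add: power_add power_int_minus)
    finally show ?case .
  qed
qed

lemma negligible_moderate: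
  assumes x: "x \<in> negligible_nets \<rho>"
  shows "x \<in> moderate \<rho>"
proof -
  have "\<forall>\<^sub>F \<epsilon> in at_right 0. \<bar>x \<epsilon>\<bar> \<le> \<rho> \<epsilon> ^ 0"
    using x unfolding negligible_nets_def by blast
  then show ?thesis unfolding moderate_def by (intro CollectI exI[of _ 0]) auto
qed

lemma moderate_const: "gauge_net \<rho> \<Longrightarrow> \<bar>c\<bar> \<le> 1 \<Longrightarrow> (\<lambda>\<epsilon>. c) \<in> moderate \<rho>"
  unfolding moderate_def by (auto intro!: exI[of _ 0])

lemma moderate_ring_cring:
  assumes g: "gauge_net \<rho>"
  shows "cring (moderate_ring \<rho>)"
proof (rule cringI)
  show "abelian_group (moderate_ring \<rho>)"
  proof (rule abelian_groupI)
    fix x assume "x \<in> carrier (moderate_ring \<rho>)"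
    then show "\<exists>y\<in>carrier (moderate_ring \<rho>). y \<oplus>\<^bsub>moderate_ring \<rho>\<^esub> x = \<zero>\<^bsub>moderate_ring \<rho>\<^esub>"
      by (intro bexI[of _ "\<lambda>\<epsilon>. - x \<epsilon>"]) (auto simp: moderate_ring_def moderate_def)
  qed (auto simp: moderate_ring_def moderate_add[OF g] moderate_const[OF g])
  show "Group.comm_monoid (moderate_ring \<rho>)"
    by (rule comm_monoidI)
      (auto simp: moderate_ring_def moderate_mult[OF g] moderate_const[OF g])
qed (auto simp: moderate_ring_def algebra_simps)

lemma negligible_ideal:
  assumes g: "gauge_net \<rho>"
  shows "ideal (negligible_nets \<rho>) (moderate_ring \<rho>)"
proof -
  interpret cring "moderate_ring \<rho>" by (rule moderate_ring_cring[OF g])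
  have inv: "inv\<^bsub>add_monoid (moderate_ring \<rho>)\<^esub> a = (\<lambda>\<epsilon>. - a \<epsilon>)" if "a \<in> moderate \<rho>" for a
    using that minus_equality[of "\<lambda>\<epsilon>. - a \<epsilon>" a]
    by (auto simp: moderate_ring_def a_inv_def moderate_def)
  show ?thesis
  proof (rule idealI)
    show "subgroup (negligible_nets \<rho>) (add_monoid (moderate_ring \<rho>))"
    proof
      show "negligible_nets \<rho> \<subseteq> carrier (add_monoid (moderate_ring \<rho>))"
        by (auto simp: moderate_ring_def negligible_moderate)
      show "\<one>\<^bsub>add_monoid (moderate_ring \<rho>)\<^esub> \<in> negligible_nets \<rho>"
        unfolding negligible_nets_def
      proof (clarify)
        fix n
        show "\<forall>\<^sub>F \<epsilon> in at_right 0. \<bar>\<one>\<^bsub>add_monoid (moderate_ring \<rho>)\<^esub> \<epsilon>\<bar> \<le> \<rho> \<epsilon> ^ n"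
          using gauge_netD[OF g] by eventually_elim (auto simp: moderate_ring_def)
      qed
    next
      fix a assume a: "a \<in> negligible_nets \<rho>"
      then show "inv\<^bsub>add_monoid (moderate_ring \<rho>)\<^esub> a \<in> negligible_nets \<rho>"
        using inv[OF negligible_moderate[OF a]] by (simp add: negligible_nets_def)
    qed (auto simp: moderate_ring_def negligible_add[OF g])
  next
    fix a b assume a: "a \<in> negligible_nets \<rho>" and b: "b \<in> carrier (moderate_ring \<rho>)"
    have "(\<lambda>\<epsilon>. a \<epsilon> * b \<epsilon>) \<in> negligible_nets \<rho>"
      using negligible_mult[OF g a] b by (simp add: moderate_ring_def)
    moreover from this have "(\<lambda>\<epsilon>. b \<epsilon> * a \<epsilon>) \<in> negligible_nets \<rho>"
      by (simp only: mult.commute)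
    ultimately show "b \<otimes>\<^bsub>moderate_ring \<rho>\<^esub> a \<in> negligible_nets \<rho>"
      "a \<otimes>\<^bsub>moderate_ring \<rho>\<^esub> b \<in> negligible_nets \<rho>"
      by (simp_all add: moderate_ring_def)
  qed (rule ring_axioms)
qed

lemma RC_cring:
  assumes g: "gauge_net \<rho>" shows "cring (RC \<rho>)"
  unfolding RC_def using negligible_ideal[OF g] moderate_ring_cring[OF g]
  by (rule ideal.quotient_is_cring)

lemma rc_class_altdef:
  assumes g: "gauge_net \<rho>" and x: "x \<in> moderate \<rho>"
  shows "rc_class \<rho> x = {y \<in> moderate \<rho>. (\<lambda>\<epsilon>. y \<epsilon> - x \<epsilon>) \<in> negligible_nets \<rho>}"
proof -
  have "rc_class \<rho> x = {\<lambda>\<epsilon>. h \<epsilon> + x \<epsilon> | h. h \<in> negligible_nets \<rho>}"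
    by (auto simp: rc_class_def a_r_coset_def' moderate_ring_def)
  also have "\<dots> = {y \<in> moderate \<rho>. (\<lambda>\<epsilon>. y \<epsilon> - x \<epsilon>) \<in> negligible_nets \<rho>}" (is "?L = ?R")
  proof
    show "?L \<subseteq> ?R" using moderate_add[OF g negligible_moderate x] by auto
    show "?R \<subseteq> ?L"
    proof
      fix y assume y: "y \<in> ?R"
      show "y \<in> ?L" using y by (intro CollectI exI[of _ "\<lambda>\<epsilon>. y \<epsilon> - x \<epsilon>"]) auto
    qed
  qed
  finally show ?thesis .
qed

lemma RC_carrier: "carrier (RC \<rho>) = rc_class \<rho> ` moderate \<rho>"
  by (auto simp: RC_def FactRing_def A_RCOSETS_def' rc_class_def moderate_ring_def)

lemma rc_abs_class:
  assumes g: "gauge_net \<rho>" and x: "x \<in> moderate \<rho>"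
  shows "rc_abs \<rho> (rc_class \<rho> x) = rc_class \<rho> (\<lambda>\<epsilon>. \<bar>x \<epsilon>\<bar>)"
proof -
  have abs: "(\<lambda>\<epsilon>. \<bar>y \<epsilon>\<bar>) \<in> moderate \<rho>" if "y \<in> moderate \<rho>" for y
    using that by (auto simp: moderate_def)
  have tri: "\<bar>\<bar>u\<bar> - \<bar>v\<bar>\<bar> \<le> \<bar>u - v\<bar>" for u v :: real by linarith
  interpret I: ideal "negligible_nets \<rho>" "moderate_ring \<rho>" by (rule negligible_ideal[OF g])
  have eq: "rc_class \<rho> (\<lambda>\<epsilon>. \<bar>y \<epsilon>\<bar>) = rc_class \<rho> (\<lambda>\<epsilon>. \<bar>x \<epsilon>\<bar>)"
    if y: "y \<in> rc_class \<rho> x" for y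
  proof -
    have "y \<in> moderate \<rho>" and "(\<lambda>\<epsilon>. y \<epsilon> - x \<epsilon>) \<in> negligible_nets \<rho>"
      using y rc_class_altdef[OF g x] by auto
    then have "(\<lambda>\<epsilon>. \<bar>y \<epsilon>\<bar> - \<bar>x \<epsilon>\<bar>) \<in> negligible_nets \<rho>"
      unfolding negligible_nets_def
      by (auto elim!: all_forward eventually_mono intro: order_trans[OF tri])
    then have "(\<lambda>\<epsilon>. \<bar>y \<epsilon>\<bar>) \<in> rc_class \<rho> (\<lambda>\<epsilon>. \<bar>x \<epsilon>\<bar>)"
      using rc_class_altdef[OF g abs[OF x]] abs[OF \<open>y \<in> moderate \<rho>\<close>] by simp
    then show ?thesis unfolding rc_class_def
      using I.a_repr_independence'[of "\<lambda>\<epsilon>. \<bar>y \<epsilon>\<bar>" "\<lambda>\<epsilon>. \<bar>x \<epsilon>\<bar>"] abs[OF x]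
      by (simp add: moderate_ring_def)
  qed
  have "x \<in> rc_class \<rho> x"
    unfolding rc_class_altdef[OF g x]
    using x additive_subgroup.zero_closed[OF I.additive_subgroup_axioms] by (auto simp: moderate_ring_def)
  then show ?thesis unfolding rc_abs_def using eq by blast
qed

end

theory Submission
  imports Defs
begin

text \<open>
  Everything is reduced to the relations \<open>X \<le> Y + d\<rho>\<^sup>q\<close>, written \<open>approx_le q X Y\<close> below. On
  representatives they mean \<open>x\<^sub>\<epsilon> \<le> y\<^sub>\<epsilon> + O(\<rho>\<^sub>\<epsilon>\<^sup>q)\<close> for small \<open>\<epsilon>\<close>, up to a loss of a bounded number of
  powers. With such a loss they are transitive, additive, and multiplicative next to fixed
  nonnegative limits, and \<open>X \<le> Y\<close> holds iff all of them do. Sharp closures and limits are expressed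
  by them as well, so limits superior can be handled as in the reals, along the filter of tails of
  the directed set of hypernaturals. That the order is only partial does no harm, because limits
  superior are defined by approximation and not as least upper bounds.
\<close>

text \<open>Where the lost powers come from: the order tolerates an error below every power of the
  gauge, so an inequality up to the \<open>q\<close>-th power of \<open>rc_d \<rho>\<close> gives
  \<open>x \<epsilon> \<le> y \<epsilon> + 2 * \<rho> \<epsilon> ^ q\<close> on representatives, and
  combining two of these yields a factor 4. Since \<rho> tends to 0,
  \<open>\<rho> \<epsilon> \<le> 1/2\<close> holds near 0, and two extra powers absorb that factor;
  this is the recurring \<open>q + 2\<close>. All definitions quantify over every exponent, so a
  fixed shift is harmless. In a product the error is also multiplied by the size of the factors,
  which is only moderate. The shift then depends on the two limits and has to be fixed before
  \<open>q\<close> and the index. A strict inequality demands an invertible difference, which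
  amounts to a gap of some power of \<rho>; errors of a higher power leave part of the gap intact. A
  limit superior consists of an eventual upper estimate and a frequent lower one. A frequent and an
  eventual property share an index, and most comparisons of limits rest on this.\<close>

lemma power_Suc_half: "0 < r \<and> r \<le> 1/2 \<Longrightarrow> r ^ Suc q \<le> r ^ q / 2" for r :: real
  using mult_right_mono[of r "1/2" "r ^ q"] by simp

lemma power_add2_quarter:
  "0 < r \<and> r \<le> 1/2 \<Longrightarrow> r ^ (q + 2) \<le> r ^ q / 4" for r :: real
proof -
  assume r: "0 < r \<and> r \<le> 1/2"
  show ?thesis using power_Suc_half[OF r, of q] power_Suc_half[OF r, of "Suc q"]
    unfolding add_2_eq_Suc' by linarith
qed

text \<open>If both \<open>a\<close> and \<open>b\<close> are at least \<open>d\<close>, multiply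
  the nonnegative numbers \<open>a - d\<close> and \<open>b - d\<close>. Otherwise one factor is
  below \<open>d\<close>, and \<open>a * b\<close> is itself of the size of the slack. The slack
  involves \<open>a\<close> and \<open>b\<close> only: they will be the fixed limits, whereas no
  upper bound for \<open>x\<close> and \<open>y\<close> is at hand.\<close>

lemma mult_le_mult_plus_slack:
  fixes a b x y d :: real
  assumes "0 \<le> a" "0 \<le> b" "0 \<le> x" "0 \<le> y" "0 \<le> d" "a \<le> x + d" "b \<le> y + d"
  shows "a * b \<le> x * y + d * (a + b + 1)"
proof (cases "d \<le> a \<and> d \<le> b")
  case True
  have "(a - d) * (b - d) \<le> x * y" using True assms by (intro mult_mono) auto
  moreover have "a * b = (a - d) * (b - d) + d * (a + b + 1) - d * (1 + d)"
    by (simp add: algebra_simps)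
  moreover have "0 \<le> d * (1 + d)" using assms by simp
  ultimately show ?thesis by linarith
next
  case False
  then have "a * b \<le> d * b \<or> b * a \<le> d * a" using assms by (auto intro: mult_right_mono)
  moreover have nonneg: "0 \<le> x * y" "0 \<le> d * a" "0 \<le> d * b" using assms by simp_all
  ultimately have "a * b \<le> d * a + d * b"
    by (elim disjE) (simp_all only: mult.commute[of b a] add_increasing add_increasing2)
  also have "\<dots> \<le> x * y + d * (a + b + 1)"
    using nonneg(1) assms(5) by (simp add: distrib_left)
  finally show ?thesis .
qed

text \<open>A locale, because the theory is used twice: with \<rho> for the values and with \<sigma>
  for the indices of a hypersequence.\<close>

locale gauge =
  fixes \<rho> :: net
  assumes gauge: "gauge_net \<rho>"
begin

section \<open>Classes of nets and the ring operations on representatives\<close>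

abbreviation "cl \<equiv> rc_class \<rho>"
abbreviation "mnets \<equiv> moderate \<rho>"

sublocale RC: cring "RC \<rho>"
  by (rule RC_cring[OF gauge])

lemma eventually_small: "\<forall>\<^sub>F \<epsilon> in at_right 0. 0 < \<rho> \<epsilon> \<and> \<rho> \<epsilon> \<le> 1/2"
  by (rule gauge_netD[OF gauge])

lemma moderate_uminus: "x \<in> mnets \<Longrightarrow> (\<lambda>\<epsilon>. - x \<epsilon>) \<in> mnets"
  by (simp add: moderate_def)

lemma moderate_diff: "x \<in> mnets \<Longrightarrow> y \<in> mnets \<Longrightarrow> (\<lambda>\<epsilon>. x \<epsilon> - y \<epsilon>) \<in> mnets"
  using moderate_add[OF gauge _ moderate_uminus] by simp

lemma moderate_abs: "x \<in> mnets \<Longrightarrow> (\<lambda>\<epsilon>. \<bar>x \<epsilon>\<bar>) \<in> mnets"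
  by (simp add: moderate_def)

lemma moderate_max: "x \<in> mnets \<Longrightarrow> (\<lambda>\<epsilon>. max 0 (x \<epsilon>)) \<in> mnets"
proof -
  assume "x \<in> mnets"
  then obtain N :: nat where "\<forall>\<^sub>F \<epsilon> in at_right 0. \<bar>x \<epsilon>\<bar> \<le> \<rho> \<epsilon> powi (- int N)"
    by (auto simp: moderate_def)
  then have "\<forall>\<^sub>F \<epsilon> in at_right 0. \<bar>max 0 (x \<epsilon>)\<bar> \<le> \<rho> \<epsilon> powi (- int N)"
    by eventually_elim linarith
  then show ?thesis unfolding moderate_def by blast
qed

lemma moderate_power: "(\<lambda>\<epsilon>. \<rho> \<epsilon> ^ q) \<in> mnets"
  unfolding moderate_def
  by (auto intro!: exI[of _ 0] eventually_mono[OF eventually_small] power_le_one)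

lemma moderate_inverse_power: "(\<lambda>\<epsilon>. inverse (\<rho> \<epsilon>) ^ q) \<in> mnets"
  unfolding moderate_def
  by (auto intro!: exI[of _ q] eventually_mono[OF eventually_small]
      simp: power_int_minus power_inverse)

lemmas moderate_intros =
  moderate_add[OF gauge] moderate_mult[OF gauge] moderate_uminus moderate_diff moderate_abs
  moderate_max moderate_power moderate_inverse_power
  moderate_const[OF gauge, of 0, simplified] moderate_const[OF gauge, of 1, simplified]

lemma class_closed [simp]: "x \<in> mnets \<Longrightarrow> cl x \<in> carrier (RC \<rho>)"
  by (simp add: RC_carrier)

lemma class_cases:
  assumes "X \<in> carrier (RC \<rho>)"
  obtains x where "x \<in> mnets" "X = cl x"
  using assms by (auto simp: RC_carrier)

lemma class_eqI:
  assumes "x \<in> mnets" "y \<in> mnets" "(\<lambda>\<epsilon>. x \<epsilon> - y \<epsilon>) \<in> negligible_nets \<rho>"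
  shows "cl x = cl y"
proof -
  interpret I: ideal "negligible_nets \<rho>" "moderate_ring \<rho>" by (rule negligible_ideal[OF gauge])
  have "x \<in> cl y" using assms by (simp add: rc_class_altdef[OF gauge])
  then show ?thesis unfolding rc_class_def
    using I.a_repr_independence'[of x y] assms by (simp add: moderate_ring_def)
qed

lemma class_eqD:
  assumes "x \<in> mnets" "y \<in> mnets" "cl x = cl y"
  shows "(\<lambda>\<epsilon>. x \<epsilon> - y \<epsilon>) \<in> negligible_nets \<rho>"
proof -
  have "(\<lambda>\<epsilon>. 0) \<in> negligible_nets \<rho>"
    by (auto simp: negligible_nets_def intro!: eventually_mono[OF eventually_small])
  then have "x \<in> cl x" using assms(1) by (simp add: rc_class_altdef[OF gauge])
  then have "x \<in> cl y" by (simp only: assms(3))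
  then show ?thesis using assms(1,2) by (simp add: rc_class_altdef[OF gauge])
qed

lemma class_eqI_eventually:
  assumes "x \<in> mnets" "y \<in> mnets" "\<forall>\<^sub>F \<epsilon> in at_right 0. x \<epsilon> = y \<epsilon>"
  shows "cl x = cl y"
proof (rule class_eqI[OF assms(1,2)])
  show "(\<lambda>\<epsilon>. x \<epsilon> - y \<epsilon>) \<in> negligible_nets \<rho>"
    unfolding negligible_nets_def using assms(3) eventually_small
    by (auto elim: eventually_elim2)
qed

lemma class_add: "x \<in> mnets \<Longrightarrow> y \<in> mnets \<Longrightarrow> cl x \<oplus>\<^bsub>RC \<rho>\<^esub> cl y = cl (\<lambda>\<epsilon>. x \<epsilon> + y \<epsilon>)"
proof -
  assume xy: "x \<in> mnets" "y \<in> mnets"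
  interpret I: ideal "negligible_nets \<rho>" "moderate_ring \<rho>" by (rule negligible_ideal[OF gauge])
  show ?thesis
    using I.a_rcos_sum[of x y] xy
    by (simp add: RC_def rc_class_def FactRing_def moderate_ring_def)
qed

lemma class_mult: "x \<in> mnets \<Longrightarrow> y \<in> mnets \<Longrightarrow> cl x \<otimes>\<^bsub>RC \<rho>\<^esub> cl y = cl (\<lambda>\<epsilon>. x \<epsilon> * y \<epsilon>)"
proof -
  assume xy: "x \<in> mnets" "y \<in> mnets"
  interpret I: ideal "negligible_nets \<rho>" "moderate_ring \<rho>" by (rule negligible_ideal[OF gauge])
  show ?thesis
    using I.rcoset_mult_add[of x y] xy
    by (simp add: RC_def rc_class_def FactRing_def moderate_ring_def)
qed

lemma class_one: "\<one>\<^bsub>RC \<rho>\<^esub> = cl (\<lambda>\<epsilon>. 1)"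
  by (simp add: RC_def FactRing_def rc_class_def moderate_ring_def)

lemma class_zero: "\<zero>\<^bsub>RC \<rho>\<^esub> = cl (\<lambda>\<epsilon>. 0)"
proof -
  \<comment> \<open>The zero of the quotient ring is the ideal itself, not written as a class; it is
    recognized as the only solution of \<open>e + e = e\<close> in the additive group.\<close>
  have "cl (\<lambda>\<epsilon>. 0) \<oplus>\<^bsub>RC \<rho>\<^esub> cl (\<lambda>\<epsilon>. 0) = cl (\<lambda>\<epsilon>. 0)"
    by (simp add: class_add moderate_intros)
  then show ?thesis
    using RC.add.r_cancel_one' [of "cl (\<lambda>\<epsilon>. 0)" "cl (\<lambda>\<epsilon>. 0)"] by (simp add: moderate_intros)
qed

lemma class_uminus: "x \<in> mnets \<Longrightarrow> \<ominus>\<^bsub>RC \<rho>\<^esub> cl x = cl (\<lambda>\<epsilon>. - x \<epsilon>)"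
  by (rule RC.minus_equality) (simp_all add: class_add class_zero moderate_intros)

lemma class_diff: "x \<in> mnets \<Longrightarrow> y \<in> mnets \<Longrightarrow> cl x \<ominus>\<^bsub>RC \<rho>\<^esub> cl y = cl (\<lambda>\<epsilon>. x \<epsilon> - y \<epsilon>)"
  by (simp add: a_minus_def class_uminus class_add moderate_intros)

lemma class_rc_d_power: "rc_d \<rho> [^]\<^bsub>RC \<rho>\<^esub> (q::nat) = cl (\<lambda>\<epsilon>. \<rho> \<epsilon> ^ q)"
proof (induction q)
  case (Suc q)
  then show ?case using moderate_power[of 1]
    by (simp add: rc_d_def class_mult moderate_intros mult.commute)
qed (simp add: class_one)

lemmas class_simps = class_add class_mult class_one class_zero class_uminus class_diff
  class_rc_d_power rc_abs_class[OF gauge]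

section \<open>The order on representatives\<close>

lemma le_class_iff:
  assumes x: "x \<in> mnets" and y: "y \<in> mnets"
  shows "rc_le \<rho> (cl x) (cl y) \<longleftrightarrow> (\<forall>q. \<forall>\<^sub>F \<epsilon> in at_right 0. x \<epsilon> \<le> y \<epsilon> + \<rho> \<epsilon> ^ q)"
proof
  assume "rc_le \<rho> (cl x) (cl y)"
  then obtain x' y' z where m: "x' \<in> mnets" "y' \<in> mnets" and c: "cl x = cl x'" "cl y = cl y'"
    and z: "z \<in> negligible_nets \<rho>" and le: "\<forall>\<^sub>F \<epsilon> in at_right 0. x' \<epsilon> \<le> y' \<epsilon> + z \<epsilon>"
    unfolding rc_le_def by blast
  have "(\<lambda>\<epsilon>. x \<epsilon> - x' \<epsilon>) \<in> negligible_nets \<rho>" "(\<lambda>\<epsilon>. y' \<epsilon> - y \<epsilon>) \<in> negligible_nets \<rho>"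
    using class_eqD m c x y by auto
  then have n: "(\<lambda>\<epsilon>. (x \<epsilon> - x' \<epsilon>) + ((y' \<epsilon> - y \<epsilon>) + z \<epsilon>)) \<in> negligible_nets \<rho>"
    by (intro negligible_add[OF gauge] z)
  show "\<forall>q. \<forall>\<^sub>F \<epsilon> in at_right 0. x \<epsilon> \<le> y \<epsilon> + \<rho> \<epsilon> ^ q"
  proof
    fix q
    have "\<forall>\<^sub>F \<epsilon> in at_right 0. \<bar>(x \<epsilon> - x' \<epsilon>) + ((y' \<epsilon> - y \<epsilon>) + z \<epsilon>)\<bar> \<le> \<rho> \<epsilon> ^ q"
      using n unfolding negligible_nets_def by blast
    with le show "\<forall>\<^sub>F \<epsilon> in at_right 0. x \<epsilon> \<le> y \<epsilon> + \<rho> \<epsilon> ^ q"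
      by eventually_elim linarith
  qed
next
  assume le: "\<forall>q. \<forall>\<^sub>F \<epsilon> in at_right 0. x \<epsilon> \<le> y \<epsilon> + \<rho> \<epsilon> ^ q"
  \<comment> \<open>The positive part of the difference is the smallest nonnegative correction that
    works for every \<epsilon>, and the hypothesis for each \<open>q\<close> says exactly that it is
    negligible.\<close>
  have "(\<lambda>\<epsilon>. max 0 (x \<epsilon> - y \<epsilon>)) \<in> negligible_nets \<rho>"
    unfolding negligible_nets_def
  proof (clarify)
    fix q
    show "\<forall>\<^sub>F \<epsilon> in at_right 0. \<bar>max 0 (x \<epsilon> - y \<epsilon>)\<bar> \<le> \<rho> \<epsilon> ^ q"
      using le[THEN spec, of q] eventually_small
      by eventually_elim (auto simp: max_def)
  qed
  moreover have "\<forall>\<^sub>F \<epsilon> in at_right (0::real). x \<epsilon> \<le> y \<epsilon> + max 0 (x \<epsilon> - y \<epsilon>)"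
    by (intro always_eventually allI) linarith
  ultimately show "rc_le \<rho> (cl x) (cl y)"
    unfolding rc_le_def by (intro bexI[OF _ x] bexI[OF _ y] conjI refl) (rule bexI)
qed

lemma le_carrierD:
  "rc_le \<rho> X Y \<Longrightarrow> X \<in> carrier (RC \<rho>)" "rc_le \<rho> X Y \<Longrightarrow> Y \<in> carrier (RC \<rho>)"
  by (auto simp: rc_le_def)

lemma le_cases:
  assumes "rc_le \<rho> X Y"
  obtains x y where "x \<in> mnets" "X = cl x" "y \<in> mnets" "Y = cl y"
proof -
  obtain x where x: "x \<in> mnets" "X = cl x"
    using le_carrierD(1)[OF assms] by (rule class_cases)
  obtain y where y: "y \<in> mnets" "Y = cl y"
    using le_carrierD(2)[OF assms] by (rule class_cases)
  show thesis by (rule that[OF x y])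
qed

lemma le_refl: "X \<in> carrier (RC \<rho>) \<Longrightarrow> rc_le \<rho> X X"
  by (erule class_cases) (auto simp: le_class_iff intro!: eventually_mono[OF eventually_small])

lemma le_trans:
  assumes "rc_le \<rho> X Y" "rc_le \<rho> Y Z"
  shows "rc_le \<rho> X Z"
proof -
  obtain x y where m: "x \<in> mnets" "X = cl x" "y \<in> mnets" "Y = cl y"
    using assms(1) by (rule le_cases)
  obtain z where z: "z \<in> mnets" "Z = cl z"
    using le_carrierD(2)[OF assms(2)] by (rule class_cases)
  note m = m z
  have "\<forall>\<^sub>F \<epsilon> in at_right 0. x \<epsilon> \<le> z \<epsilon> + \<rho> \<epsilon> ^ q" for q
  proof -
    have "\<forall>\<^sub>F \<epsilon> in at_right 0. x \<epsilon> \<le> y \<epsilon> + \<rho> \<epsilon> ^ Suc q"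
      "\<forall>\<^sub>F \<epsilon> in at_right 0. y \<epsilon> \<le> z \<epsilon> + \<rho> \<epsilon> ^ Suc q"
      using assms m le_class_iff[of x y] le_class_iff[of y z] by (auto simp del: power_Suc)
    with eventually_small show ?thesis
    proof eventually_elim
      case (elim \<epsilon>)
      then show ?case using power_Suc_half[of "\<rho> \<epsilon>" q] by linarith
    qed
  qed
  with m show ?thesis by (simp add: le_class_iff)
qed

lemma le_antisym:
  assumes "rc_le \<rho> X Y" "rc_le \<rho> Y X"
  shows "X = Y"
proof -
  obtain x y where m: "x \<in> mnets" "X = cl x" "y \<in> mnets" "Y = cl y"
    using assms(1) by (rule le_cases)
  have "\<forall>\<^sub>F \<epsilon> in at_right 0. \<bar>x \<epsilon> - y \<epsilon>\<bar> \<le> \<rho> \<epsilon> ^ q" for q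
  proof -
    have "\<forall>\<^sub>F \<epsilon> in at_right 0. x \<epsilon> \<le> y \<epsilon> + \<rho> \<epsilon> ^ q"
      "\<forall>\<^sub>F \<epsilon> in at_right 0. y \<epsilon> \<le> x \<epsilon> + \<rho> \<epsilon> ^ q"
      using assms m le_class_iff[of x y] le_class_iff[of y x] by auto
    then show ?thesis by eventually_elim linarith
  qed
  then have "cl x = cl y" using m by (intro class_eqI) (auto simp: negligible_nets_def)
  with m show ?thesis by simp
qed

text \<open>The negative part of a representative is negligible, so cutting it off with
  \<open>max\<close> stays in the class. Having the sign at every \<epsilon> allows products to be
  estimated pointwise.\<close>

lemma le_zero_cases:
  assumes "rc_le \<rho> \<zero>\<^bsub>RC \<rho>\<^esub> X"
  obtains x where "x \<in> mnets" "X = cl x" "\<And>\<epsilon>. 0 \<le> x \<epsilon>"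
proof -
  obtain x where x: "x \<in> mnets" "X = cl x"
    using le_carrierD(2)[OF assms] by (rule class_cases)
  have "cl x = cl (\<lambda>\<epsilon>. max 0 (x \<epsilon>))"
  proof (rule class_eqI)
    have le: "\<forall>\<^sub>F \<epsilon> in at_right 0. 0 \<le> x \<epsilon> + \<rho> \<epsilon> ^ q" for q
      using assms x le_class_iff[of "\<lambda>_. 0" x] by (simp add: class_zero moderate_intros)
    show "(\<lambda>\<epsilon>. x \<epsilon> - max 0 (x \<epsilon>)) \<in> negligible_nets \<rho>"
      unfolding negligible_nets_def
    proof (clarify)
      fix q
      show "\<forall>\<^sub>F \<epsilon> in at_right 0. \<bar>x \<epsilon> - max 0 (x \<epsilon>)\<bar> \<le> \<rho> \<epsilon> ^ q"
        using le[of q] eventually_small by eventually_elim (auto simp: max_def)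
    qed
  qed (use x in \<open>auto intro: moderate_intros\<close>)
  with x show thesis by (intro that[of "\<lambda>\<epsilon>. max 0 (x \<epsilon>)"]) (auto intro: moderate_intros)
qed

text \<open>
  For a nonnegative number, invertibility means being bounded below by some power of the gauge.
\<close>

lemma less_class_iff:
  assumes x: "x \<in> mnets" and y: "y \<in> mnets"
  shows "rc_less \<rho> (cl x) (cl y) \<longleftrightarrow> (\<exists>m. \<forall>\<^sub>F \<epsilon> in at_right 0. x \<epsilon> + \<rho> \<epsilon> ^ m \<le> y \<epsilon>)"
proof
  assume "rc_less \<rho> (cl x) (cl y)"
  then have le: "rc_le \<rho> (cl x) (cl y)" and u: "cl y \<ominus>\<^bsub>RC \<rho>\<^esub> cl x \<in> Units (RC \<rho>)"
    by (auto simp: rc_less_def)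
  obtain V where V: "V \<in> carrier (RC \<rho>)" "(cl y \<ominus>\<^bsub>RC \<rho>\<^esub> cl x) \<otimes>\<^bsub>RC \<rho>\<^esub> V = \<one>\<^bsub>RC \<rho>\<^esub>"
    using u by (auto simp: Units_def)
  then obtain v where v: "v \<in> mnets" "V = cl v" by (auto elim: class_cases)
  then have "cl (\<lambda>\<epsilon>. (y \<epsilon> - x \<epsilon>) * v \<epsilon>) = cl (\<lambda>\<epsilon>. 1)"
    using V x y by (simp add: class_simps moderate_intros)
  then have "(\<lambda>\<epsilon>. (y \<epsilon> - x \<epsilon>) * v \<epsilon> - 1) \<in> negligible_nets \<rho>"
    by (rule class_eqD[rotated 2]) (use v x y in \<open>auto intro!: moderate_intros\<close>)
  then have n: "\<forall>\<^sub>F \<epsilon> in at_right 0. \<bar>(y \<epsilon> - x \<epsilon>) * v \<epsilon> - 1\<bar> \<le> \<rho> \<epsilon> ^ 1"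
    unfolding negligible_nets_def by blast
  obtain N :: nat where N: "\<forall>\<^sub>F \<epsilon> in at_right 0. \<bar>v \<epsilon>\<bar> \<le> \<rho> \<epsilon> powi (- int N)"
    using v by (auto simp: moderate_def)
  \<comment> \<open>The inverse \<open>v\<close> forces the difference to have absolute value at
    least \<open>\<rho> \<epsilon> ^ N / 2\<close>. The exponent \<open>N + 2\<close> limits how
    negative the difference can be to \<open>\<rho> \<epsilon> ^ N / 4\<close>, which rules out the
    negative sign.\<close>
  have "\<forall>\<^sub>F \<epsilon> in at_right 0. x \<epsilon> \<le> y \<epsilon> + \<rho> \<epsilon> ^ (N + 2)"
    using le le_class_iff[OF x y] by blast
  with n N eventually_small have "\<forall>\<^sub>F \<epsilon> in at_right 0. x \<epsilon> + \<rho> \<epsilon> ^ Suc N \<le> y \<epsilon>"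
  proof eventually_elim
    case (elim \<epsilon>)
    let ?w = "y \<epsilon> - x \<epsilon>"
    have "1/2 \<le> \<bar>?w * v \<epsilon>\<bar>" using elim by auto
    also have "\<dots> \<le> \<bar>?w\<bar> * \<rho> \<epsilon> powi (- int N)"
      using elim unfolding abs_mult by (intro mult_left_mono) auto
    finally have "\<rho> \<epsilon> ^ N / 2 \<le> \<bar>?w\<bar>"
      using elim by (simp add: power_int_minus field_simps)
    moreover have "\<rho> \<epsilon> ^ (N + 2) \<le> \<rho> \<epsilon> ^ N / 4" "\<rho> \<epsilon> ^ Suc N \<le> \<rho> \<epsilon> ^ N / 2" "0 < \<rho> \<epsilon> ^ N"
      using elim power_Suc_half power_add2_quarter by auto
    ultimately show ?case using elim by linarith
  qed
  then show "\<exists>m. \<forall>\<^sub>F \<epsilon> in at_right 0. x \<epsilon> + \<rho> \<epsilon> ^ m \<le> y \<epsilon>" by blast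
next
  assume "\<exists>m. \<forall>\<^sub>F \<epsilon> in at_right 0. x \<epsilon> + \<rho> \<epsilon> ^ m \<le> y \<epsilon>"
  then obtain m where m: "\<forall>\<^sub>F \<epsilon> in at_right 0. x \<epsilon> + \<rho> \<epsilon> ^ m \<le> y \<epsilon>" by blast
  \<comment> \<open>The gap keeps the difference away from 0 near 0, so the reciprocal is a true
    inverse there, of size at most \<open>\<rho> \<epsilon> powi (- int m)\<close>.\<close>
  let ?v = "\<lambda>\<epsilon>. inverse (y \<epsilon> - x \<epsilon>)"
  have v: "?v \<in> mnets"
  proof -
    have "\<forall>\<^sub>F \<epsilon> in at_right 0. \<bar>?v \<epsilon>\<bar> \<le> \<rho> \<epsilon> powi (- int m)"
      using m eventually_small
    proof eventually_elim
      case (elim \<epsilon>)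
      have "0 < \<rho> \<epsilon> ^ m" using elim by auto
      then show ?case using elim by (auto simp: power_int_minus intro!: le_imp_inverse_le)
    qed
    then show ?thesis unfolding moderate_def by blast
  qed
  have "cl (\<lambda>\<epsilon>. (y \<epsilon> - x \<epsilon>) * ?v \<epsilon>) = cl (\<lambda>\<epsilon>. 1)"
  proof (rule class_eqI_eventually)
    show "\<forall>\<^sub>F \<epsilon> in at_right 0. (y \<epsilon> - x \<epsilon>) * ?v \<epsilon> = 1"
      using m eventually_small
    proof eventually_elim
      case (elim \<epsilon>)
      have "0 < \<rho> \<epsilon> ^ m" using elim by auto
      then have "y \<epsilon> - x \<epsilon> \<noteq> 0" using elim by linarith
      then show ?case by simp
    qed
  qed (use x y v in \<open>auto intro!: moderate_intros\<close>)
  then have "(cl y \<ominus>\<^bsub>RC \<rho>\<^esub> cl x) \<otimes>\<^bsub>RC \<rho>\<^esub> cl ?v = \<one>\<^bsub>RC \<rho>\<^esub>"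
    using x y v by (simp add: class_simps moderate_intros)
  then have "cl y \<ominus>\<^bsub>RC \<rho>\<^esub> cl x \<in> Units (RC \<rho>)"
    using x y v RC.m_comm[of "cl y \<ominus>\<^bsub>RC \<rho>\<^esub> cl x" "cl ?v"] unfolding Units_def
    by (auto intro!: bexI[of _ "cl ?v"])
  moreover have "rc_le \<rho> (cl x) (cl y)"
    unfolding le_class_iff[OF x y]
  proof
    fix q
    show "\<forall>\<^sub>F \<epsilon> in at_right 0. x \<epsilon> \<le> y \<epsilon> + \<rho> \<epsilon> ^ q"
      using m eventually_small
    proof eventually_elim
      case (elim \<epsilon>)
      then have "0 < \<rho> \<epsilon> ^ m" "0 < \<rho> \<epsilon> ^ q" by auto
      then show ?case using elim by linarith
    qed
  qed
  ultimately show "rc_less \<rho> (cl x) (cl y)" by (simp add: rc_less_def)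
qed

lemma less_irrefl: "\<not> rc_less \<rho> X X"
proof
  assume less: "rc_less \<rho> X X"
  then have "X \<in> carrier (RC \<rho>)" unfolding rc_less_def by (blast dest: le_carrierD)
  then obtain x where x: "x \<in> mnets" "X = cl x" by (rule class_cases)
  then obtain m where "\<forall>\<^sub>F \<epsilon> in at_right 0. x \<epsilon> + \<rho> \<epsilon> ^ m \<le> x \<epsilon>"
    using less less_class_iff[of x x] by auto
  with eventually_small have "\<forall>\<^sub>F \<epsilon> in at_right (0::real). False"
    by eventually_elim (auto dest: zero_less_power[of _ m])
  then show False by simp
qed

lemma less_le_trans:
  assumes "rc_less \<rho> X Y" "rc_le \<rho> Y Z"
  shows "rc_less \<rho> X Z"
proof -
  obtain x y where m: "x \<in> mnets" "X = cl x" "y \<in> mnets" "Y = cl y"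
    using assms(1) unfolding rc_less_def by (blast elim: le_cases)
  obtain z where z: "z \<in> mnets" "Z = cl z"
    using le_carrierD(2)[OF assms(2)] by (rule class_cases)
  note m = m z
  obtain k where "\<forall>\<^sub>F \<epsilon> in at_right 0. x \<epsilon> + \<rho> \<epsilon> ^ k \<le> y \<epsilon>"
    using assms m less_class_iff[of x y] by auto
  \<comment> \<open>An error one power finer than the gap uses up at most half of it.\<close>
  moreover have "\<forall>\<^sub>F \<epsilon> in at_right 0. y \<epsilon> \<le> z \<epsilon> + \<rho> \<epsilon> ^ Suc k"
    using assms m le_class_iff[of y z] by (auto simp del: power_Suc)
  ultimately have "\<forall>\<^sub>F \<epsilon> in at_right 0. x \<epsilon> + \<rho> \<epsilon> ^ Suc k \<le> z \<epsilon>"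
    using eventually_small
  proof eventually_elim
    case (elim \<epsilon>)
    then show ?case using power_Suc_half[of "\<rho> \<epsilon>" k] by linarith
  qed
  then have "\<exists>m. \<forall>\<^sub>F \<epsilon> in at_right 0. x \<epsilon> + \<rho> \<epsilon> ^ m \<le> z \<epsilon>" by blast
  with m z show ?thesis by (simp add: less_class_iff)
qed

subsection \<open>Inequalities up to a power of the gauge\<close>

text \<open>Membership of \<open>Y\<close> is required explicitly because \<open>rc_le\<close>
  speaks only of the sum on its right. Thus every such fact provides representatives of both
  sides.\<close>

definition approx_le :: "nat \<Rightarrow> gnum \<Rightarrow> gnum \<Rightarrow> bool" where
  "approx_le q X Y \<longleftrightarrow> X \<in> carrier (RC \<rho>) \<and> Y \<in> carrier (RC \<rho>) \<and>
    rc_le \<rho> X (Y \<oplus>\<^bsub>RC \<rho>\<^esub> rc_d \<rho> [^]\<^bsub>RC \<rho>\<^esub> q)"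

lemma approx_le_classI:
  assumes "x \<in> mnets" "y \<in> mnets" "\<forall>\<^sub>F \<epsilon> in at_right 0. x \<epsilon> \<le> y \<epsilon> + \<rho> \<epsilon> ^ q"
  shows "approx_le q (cl x) (cl y)"
proof -
  have "\<forall>\<^sub>F \<epsilon> in at_right 0. x \<epsilon> \<le> y \<epsilon> + \<rho> \<epsilon> ^ q + \<rho> \<epsilon> ^ r" for r
    using assms(3) eventually_small
  proof eventually_elim
    case (elim \<epsilon>)
    then have "0 < \<rho> \<epsilon> ^ r" by simp
    then show ?case using elim by linarith
  qed
  with assms show ?thesis
    by (simp add: approx_le_def class_simps le_class_iff moderate_intros)
qed

text \<open>The extra error hidden in \<open>rc_le\<close> is below every power; bounding it by the
  \<open>q\<close>-th power itself produces the factor 2. This form is handier than the exact one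
  wherever some powers may be lost.\<close>

lemma approx_le_classD:
  assumes "x \<in> mnets" "y \<in> mnets" "approx_le q (cl x) (cl y)"
  shows "\<forall>\<^sub>F \<epsilon> in at_right 0. x \<epsilon> \<le> y \<epsilon> + 2 * \<rho> \<epsilon> ^ q"
proof -
  have "\<forall>r. \<forall>\<^sub>F \<epsilon> in at_right 0. x \<epsilon> \<le> y \<epsilon> + \<rho> \<epsilon> ^ q + \<rho> \<epsilon> ^ r"
    using assms by (simp add: approx_le_def class_simps le_class_iff moderate_intros)
  then have "\<forall>\<^sub>F \<epsilon> in at_right 0. x \<epsilon> \<le> y \<epsilon> + \<rho> \<epsilon> ^ q + \<rho> \<epsilon> ^ q" by blast
  then show ?thesis by eventually_elim simp
qed

lemma approx_le_carrierD:
  "approx_le q X Y \<Longrightarrow> X \<in> carrier (RC \<rho>)" "approx_le q X Y \<Longrightarrow> Y \<in> carrier (RC \<rho>)"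
  by (simp_all add: approx_le_def)

lemma approx_le_cases:
  assumes "approx_le q X Y"
  obtains x y where "x \<in> mnets" "X = cl x" "y \<in> mnets" "Y = cl y"
proof -
  obtain x where x: "x \<in> mnets" "X = cl x"
    using approx_le_carrierD(1)[OF assms] by (rule class_cases)
  obtain y where y: "y \<in> mnets" "Y = cl y"
    using approx_le_carrierD(2)[OF assms] by (rule class_cases)
  show thesis by (rule that[OF x y])
qed

lemma le_imp_approx_le:
  assumes "rc_le \<rho> X Y"
  shows "approx_le q X Y"
proof -
  obtain x y where "x \<in> mnets" "X = cl x" "y \<in> mnets" "Y = cl y"
    using assms by (rule le_cases)
  with assms show ?thesis by (simp add: le_class_iff approx_le_classI)
qed

lemma approx_le_trans:
  assumes "approx_le (q + 2) X Y" "approx_le (q + 2) Y Z"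
  shows "approx_le q X Z"
proof -
  obtain x y where m: "x \<in> mnets" "X = cl x" "y \<in> mnets" "Y = cl y"
    using assms(1) by (rule approx_le_cases)
  obtain z where z: "z \<in> mnets" "Z = cl z"
    using approx_le_carrierD(2)[OF assms(2)] by (rule class_cases)
  have "\<forall>\<^sub>F \<epsilon> in at_right 0. x \<epsilon> \<le> y \<epsilon> + 2 * \<rho> \<epsilon> ^ (q + 2)"
    "\<forall>\<^sub>F \<epsilon> in at_right 0. y \<epsilon> \<le> z \<epsilon> + 2 * \<rho> \<epsilon> ^ (q + 2)"
    by (rule approx_le_classD; use assms m z in blast)+
  with eventually_small have "\<forall>\<^sub>F \<epsilon> in at_right 0. x \<epsilon> \<le> z \<epsilon> + \<rho> \<epsilon> ^ q"
  proof eventually_elim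
    case (elim \<epsilon>)
    then show ?case using power_add2_quarter[of "\<rho> \<epsilon>" q] by linarith
  qed
  with m z show ?thesis by (simp add: approx_le_classI)
qed

text \<open>The lossless description, for the facts that must keep the exponent: weakening it,
  moving the power to the other side, and negation.\<close>

lemma approx_le_class_iff:
  assumes "x \<in> mnets" "y \<in> mnets"
  shows "approx_le q (cl x) (cl y) \<longleftrightarrow> (\<forall>r. \<forall>\<^sub>F \<epsilon> in at_right 0. x \<epsilon> \<le> y \<epsilon> + \<rho> \<epsilon> ^ q + \<rho> \<epsilon> ^ r)"
  using assms by (simp add: approx_le_def class_simps le_class_iff moderate_intros)

lemma approx_le_antimono:
  assumes "approx_le q' X Y" "q \<le> q'"
  shows "approx_le q X Y"
proof -
  obtain x y where m: "x \<in> mnets" "X = cl x" "y \<in> mnets" "Y = cl y"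
    using assms(1) by (rule approx_le_cases)
  have "\<forall>\<^sub>F \<epsilon> in at_right 0. x \<epsilon> \<le> y \<epsilon> + \<rho> \<epsilon> ^ q + \<rho> \<epsilon> ^ r" for r
  proof -
    have "\<forall>\<^sub>F \<epsilon> in at_right 0. x \<epsilon> \<le> y \<epsilon> + \<rho> \<epsilon> ^ q' + \<rho> \<epsilon> ^ r"
      using assms(1) m by (simp add: approx_le_class_iff)
    with eventually_small show ?thesis
    proof eventually_elim
      case (elim \<epsilon>)
      then have "\<rho> \<epsilon> ^ q' \<le> \<rho> \<epsilon> ^ q" using assms(2) by (intro power_decreasing) auto
      with elim show ?case by linarith
    qed
  qed
  with m show ?thesis by (simp add: approx_le_class_iff)
qed

lemma le_if_approx_le:
  assumes "\<And>q. approx_le q X Y"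
  shows "rc_le \<rho> X Y"
proof -
  obtain x y where m: "x \<in> mnets" "X = cl x" "y \<in> mnets" "Y = cl y"
    using assms(1) by (rule approx_le_cases)
  have "\<forall>\<^sub>F \<epsilon> in at_right 0. x \<epsilon> \<le> y \<epsilon> + \<rho> \<epsilon> ^ q" for q
  proof -
    have "\<forall>\<^sub>F \<epsilon> in at_right 0. x \<epsilon> \<le> y \<epsilon> + 2 * \<rho> \<epsilon> ^ Suc q"
      by (rule approx_le_classD) (use assms m in simp_all)
    with eventually_small show ?thesis
    proof eventually_elim
      case (elim \<epsilon>)
      then show ?case using power_Suc_half[of "\<rho> \<epsilon>" q] by linarith
    qed
  qed
  with m show ?thesis by (simp add: le_class_iff)
qed

text \<open>Brings the conditions of limits superior and inferior that subtract a power of the gauge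
  into the same form as those that add one.\<close>

lemma approx_le_diff_iff:
  assumes "X \<in> carrier (RC \<rho>)" "Y \<in> carrier (RC \<rho>)"
  shows "rc_le \<rho> (X \<ominus>\<^bsub>RC \<rho>\<^esub> rc_d \<rho> [^]\<^bsub>RC \<rho>\<^esub> q) Y \<longleftrightarrow> approx_le q X Y"
proof -
  obtain x y where m: "x \<in> mnets" "X = cl x" "y \<in> mnets" "Y = cl y"
    using assms by (metis class_cases)
  then show ?thesis
    by (simp add: approx_le_class_iff class_simps le_class_iff moderate_intros algebra_simps)
qed

lemma approx_le_uminus_iff:
  assumes "X \<in> carrier (RC \<rho>)" "Y \<in> carrier (RC \<rho>)"
  shows "approx_le q (\<ominus>\<^bsub>RC \<rho>\<^esub> X) (\<ominus>\<^bsub>RC \<rho>\<^esub> Y) \<longleftrightarrow> approx_le q Y X"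
proof -
  obtain x y where m: "x \<in> mnets" "X = cl x" "y \<in> mnets" "Y = cl y"
    using assms by (metis class_cases)
  have *: "- u \<le> c - v + d \<longleftrightarrow> v \<le> u + c + d" for u v c d :: real by linarith
  from m show ?thesis
    by (simp add: approx_le_class_iff class_uminus moderate_intros *)
qed

lemma approx_le_add:
  assumes "approx_le (q + 2) X Y" "approx_le (q + 2) X' Y'"
  shows "approx_le q (X \<oplus>\<^bsub>RC \<rho>\<^esub> X') (Y \<oplus>\<^bsub>RC \<rho>\<^esub> Y')"
proof -
  obtain x y where m: "x \<in> mnets" "X = cl x" "y \<in> mnets" "Y = cl y"
    using assms(1) by (rule approx_le_cases)
  obtain x' y' where m': "x' \<in> mnets" "X' = cl x'" "y' \<in> mnets" "Y' = cl y'"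
    using assms(2) by (rule approx_le_cases)
  have "\<forall>\<^sub>F \<epsilon> in at_right 0. x \<epsilon> \<le> y \<epsilon> + 2 * \<rho> \<epsilon> ^ (q + 2)"
    "\<forall>\<^sub>F \<epsilon> in at_right 0. x' \<epsilon> \<le> y' \<epsilon> + 2 * \<rho> \<epsilon> ^ (q + 2)"
    by (rule approx_le_classD; use assms m m' in blast)+
  with eventually_small have "\<forall>\<^sub>F \<epsilon> in at_right 0. x \<epsilon> + x' \<epsilon> \<le> (y \<epsilon> + y' \<epsilon>) + \<rho> \<epsilon> ^ q"
  proof eventually_elim
    case (elim \<epsilon>)
    then show ?case using power_add2_quarter[of "\<rho> \<epsilon>" q] by linarith
  qed
  with m m' show ?thesis by (simp add: class_add approx_le_classI moderate_intros)
qed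

text \<open>In both directions the error is \<open>d * (a + b + 1)\<close> with \<open>d\<close> a
  power of the gauge. The net \<open>a + b + 1\<close> is moderate, hence at most the power
  \<open>- M\<close>, so \<open>M\<close> powers pay for it and two more for the factor 2 of
  \<open>approx_le_classD\<close>. Only \<open>A\<close> and \<open>B\<close> determine
  \<open>N\<close>, so one \<open>N\<close> serves all terms of a hypersequence and all
  \<open>q\<close>.\<close>

lemma approx_le_mult:
  assumes "rc_le \<rho> \<zero>\<^bsub>RC \<rho>\<^esub> A" "rc_le \<rho> \<zero>\<^bsub>RC \<rho>\<^esub> B"
  obtains N where
    "\<And>q X Y. rc_le \<rho> \<zero>\<^bsub>RC \<rho>\<^esub> X \<Longrightarrow> rc_le \<rho> \<zero>\<^bsub>RC \<rho>\<^esub> Y \<Longrightarrow> approx_le (q + N) X A \<Longrightarrow> approx_le (q + N) Y B \<Longrightarrow>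
      approx_le q (X \<otimes>\<^bsub>RC \<rho>\<^esub> Y) (A \<otimes>\<^bsub>RC \<rho>\<^esub> B)"
    "\<And>q X Y. rc_le \<rho> \<zero>\<^bsub>RC \<rho>\<^esub> X \<Longrightarrow> rc_le \<rho> \<zero>\<^bsub>RC \<rho>\<^esub> Y \<Longrightarrow> approx_le (q + N) A X \<Longrightarrow> approx_le (q + N) B Y \<Longrightarrow>
      approx_le q (A \<otimes>\<^bsub>RC \<rho>\<^esub> B) (X \<otimes>\<^bsub>RC \<rho>\<^esub> Y)"
proof -
  obtain a where a: "a \<in> mnets" "A = cl a" "\<And>\<epsilon>. 0 \<le> a \<epsilon>" using assms(1) by (rule le_zero_cases) blast
  obtain b where b: "b \<in> mnets" "B = cl b" "\<And>\<epsilon>. 0 \<le> b \<epsilon>" using assms(2) by (rule le_zero_cases) blast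
  have "(\<lambda>\<epsilon>. (a \<epsilon> + b \<epsilon>) + 1) \<in> mnets" using a b by (intro moderate_intros)
  then obtain M :: nat where M: "\<forall>\<^sub>F \<epsilon> in at_right 0. \<bar>(a \<epsilon> + b \<epsilon>) + 1\<bar> \<le> \<rho> \<epsilon> powi (- int M)"
    by (auto simp: moderate_def)
  have bound: "\<forall>\<^sub>F \<epsilon> in at_right 0. \<rho> \<epsilon> ^ (q + M) * (a \<epsilon> + b \<epsilon> + 1) \<le> \<rho> \<epsilon> ^ q" for q
    using M eventually_small
  proof eventually_elim
    case (elim \<epsilon>)
    have "\<rho> \<epsilon> ^ (q + M) * (a \<epsilon> + b \<epsilon> + 1) \<le> \<rho> \<epsilon> ^ (q + M) * \<rho> \<epsilon> powi (- int M)"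
      using elim by (intro mult_left_mono) auto
    also have "\<dots> = \<rho> \<epsilon> ^ q" using elim by (simp add: power_add power_int_minus)
    finally show ?case .
  qed
  show thesis
  proof (rule that[of "M + 2"])
    fix q X Y
    assume X: "rc_le \<rho> \<zero>\<^bsub>RC \<rho>\<^esub> X" and Y: "rc_le \<rho> \<zero>\<^bsub>RC \<rho>\<^esub> Y"
      and XA: "approx_le (q + (M + 2)) X A" and YB: "approx_le (q + (M + 2)) Y B"
    obtain x where x: "x \<in> mnets" "X = cl x" "\<And>\<epsilon>. 0 \<le> x \<epsilon>" using X by (rule le_zero_cases) blast
    obtain y where y: "y \<in> mnets" "Y = cl y" "\<And>\<epsilon>. 0 \<le> y \<epsilon>" using Y by (rule le_zero_cases) blast
    have "\<forall>\<^sub>F \<epsilon> in at_right 0. x \<epsilon> \<le> a \<epsilon> + 2 * \<rho> \<epsilon> ^ (q + M + 2)"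
      "\<forall>\<^sub>F \<epsilon> in at_right 0. y \<epsilon> \<le> b \<epsilon> + 2 * \<rho> \<epsilon> ^ (q + M + 2)"
      by (rule approx_le_classD; use XA YB x y a b in \<open>simp only: add.assoc\<close>)+
    with eventually_small bound[of q]
    have "\<forall>\<^sub>F \<epsilon> in at_right 0. x \<epsilon> * y \<epsilon> \<le> a \<epsilon> * b \<epsilon> + \<rho> \<epsilon> ^ q"
    proof eventually_elim
      case (elim \<epsilon>)
      let ?d = "\<rho> \<epsilon> ^ (q + M)"
      have d: "0 \<le> ?d" "?d \<le> 1" using elim by (auto intro: power_le_one)
      have "x \<epsilon> \<le> a \<epsilon> + ?d" "y \<epsilon> \<le> b \<epsilon> + ?d"
        using elim d power_add2_quarter[of "\<rho> \<epsilon>" "q + M"] by linarith+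
      then have "x \<epsilon> * y \<epsilon> \<le> (a \<epsilon> + ?d) * (b \<epsilon> + ?d)"
        using x(3)[of \<epsilon>] y(3)[of \<epsilon>] a(3)[of \<epsilon>] b(3)[of \<epsilon>] d by (intro mult_mono) auto
      also have "\<dots> = a \<epsilon> * b \<epsilon> + ?d * (a \<epsilon> + b \<epsilon> + ?d)" by (simp only: algebra_simps)
      \<comment> \<open>The square of the error is absorbed by using that it is at most 1.\<close>
      also have "\<dots> \<le> a \<epsilon> * b \<epsilon> + ?d * (a \<epsilon> + b \<epsilon> + 1)"
        using d by (intro add_left_mono mult_left_mono) auto
      finally show ?case using elim by linarith
    qed
    then show "approx_le q (X \<otimes>\<^bsub>RC \<rho>\<^esub> Y) (A \<otimes>\<^bsub>RC \<rho>\<^esub> B)"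
      using x y a b by (simp add: class_mult approx_le_classI moderate_intros)
  next
    fix q X Y
    assume X: "rc_le \<rho> \<zero>\<^bsub>RC \<rho>\<^esub> X" and Y: "rc_le \<rho> \<zero>\<^bsub>RC \<rho>\<^esub> Y"
      and AX: "approx_le (q + (M + 2)) A X" and BY: "approx_le (q + (M + 2)) B Y"
    obtain x where x: "x \<in> mnets" "X = cl x" "\<And>\<epsilon>. 0 \<le> x \<epsilon>" using X by (rule le_zero_cases) blast
    obtain y where y: "y \<in> mnets" "Y = cl y" "\<And>\<epsilon>. 0 \<le> y \<epsilon>" using Y by (rule le_zero_cases) blast
    have "\<forall>\<^sub>F \<epsilon> in at_right 0. a \<epsilon> \<le> x \<epsilon> + 2 * \<rho> \<epsilon> ^ (q + M + 2)"
      "\<forall>\<^sub>F \<epsilon> in at_right 0. b \<epsilon> \<le> y \<epsilon> + 2 * \<rho> \<epsilon> ^ (q + M + 2)"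
      by (rule approx_le_classD; use AX BY x y a b in \<open>simp only: add.assoc\<close>)+
    with eventually_small bound[of q]
    have "\<forall>\<^sub>F \<epsilon> in at_right 0. a \<epsilon> * b \<epsilon> \<le> x \<epsilon> * y \<epsilon> + \<rho> \<epsilon> ^ q"
    proof eventually_elim
      case (elim \<epsilon>)
      let ?d = "\<rho> \<epsilon> ^ (q + M)"
      have d: "0 \<le> ?d" using elim by auto
      have "a \<epsilon> \<le> x \<epsilon> + ?d" "b \<epsilon> \<le> y \<epsilon> + ?d"
        using elim d power_add2_quarter[of "\<rho> \<epsilon>" "q + M"] by linarith+
      \<comment> \<open>Here \<open>x\<close> and \<open>y\<close> are bounded only from below, so
        the error must be expressed through \<open>a\<close> and \<open>b\<close>; expanding a
        product of the upper estimates would leave \<open>x\<close> and \<open>y\<close> in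
        it.\<close>
      then have "a \<epsilon> * b \<epsilon> \<le> x \<epsilon> * y \<epsilon> + ?d * (a \<epsilon> + b \<epsilon> + 1)"
        using x(3)[of \<epsilon>] y(3)[of \<epsilon>] a(3)[of \<epsilon>] b(3)[of \<epsilon>] d by (intro mult_le_mult_plus_slack)
      with elim show ?case by linarith
    qed
    then show "approx_le q (A \<otimes>\<^bsub>RC \<rho>\<^esub> B) (X \<otimes>\<^bsub>RC \<rho>\<^esub> Y)"
      using x y a b by (simp add: class_mult approx_le_classI moderate_intros)
  qed
qed

lemma abs_diff_less_imp_approx_le:
  assumes "X \<in> carrier (RC \<rho>)" "Y \<in> carrier (RC \<rho>)"
    and "rc_less \<rho> (rc_abs \<rho> (X \<ominus>\<^bsub>RC \<rho>\<^esub> Y)) (rc_d \<rho> [^]\<^bsub>RC \<rho>\<^esub> (q::nat))"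
  shows "approx_le q X Y" "approx_le q Y X"
proof -
  obtain x y where m: "x \<in> mnets" "X = cl x" "y \<in> mnets" "Y = cl y"
    using assms(1,2) by (metis class_cases)
  obtain k where "\<forall>\<^sub>F \<epsilon> in at_right 0. \<bar>x \<epsilon> - y \<epsilon>\<bar> + \<rho> \<epsilon> ^ k \<le> \<rho> \<epsilon> ^ q"
    using assms(3) m by (auto simp: class_simps less_class_iff moderate_intros)
  with eventually_small have "\<forall>\<^sub>F \<epsilon> in at_right 0. \<bar>x \<epsilon> - y \<epsilon>\<bar> \<le> \<rho> \<epsilon> ^ q"
  proof eventually_elim
    case (elim \<epsilon>)
    then have "0 < \<rho> \<epsilon> ^ k" by simp
    then show ?case using elim by linarith
  qed
  then have "\<forall>\<^sub>F \<epsilon> in at_right 0. x \<epsilon> \<le> y \<epsilon> + \<rho> \<epsilon> ^ q" "\<forall>\<^sub>F \<epsilon> in at_right 0. y \<epsilon> \<le> x \<epsilon> + \<rho> \<epsilon> ^ q"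
    by (eventually_elim, linarith)+
  with m show "approx_le q X Y" "approx_le q Y X" by (simp_all add: approx_le_classI)
qed

lemma approx_le_imp_abs_diff_less:
  assumes "approx_le (q + 2) X Y" "approx_le (q + 2) Y X"
  shows "rc_less \<rho> (rc_abs \<rho> (X \<ominus>\<^bsub>RC \<rho>\<^esub> Y)) (rc_d \<rho> [^]\<^bsub>RC \<rho>\<^esub> q)"
proof -
  obtain x y where m: "x \<in> mnets" "X = cl x" "y \<in> mnets" "Y = cl y"
    using assms(1) by (rule approx_le_cases)
  have "\<forall>\<^sub>F \<epsilon> in at_right 0. x \<epsilon> \<le> y \<epsilon> + 2 * \<rho> \<epsilon> ^ (q + 2)"
    "\<forall>\<^sub>F \<epsilon> in at_right 0. y \<epsilon> \<le> x \<epsilon> + 2 * \<rho> \<epsilon> ^ (q + 2)"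
    by (rule approx_le_classD; use assms m in blast)+
  \<comment> \<open>The two spare powers reduce the distance to half of
    \<open>\<rho> \<epsilon> ^ q\<close>; the other half has room for the gap
    \<open>\<rho> \<epsilon> ^ Suc q\<close> that strictness demands.\<close>
  with eventually_small have "\<forall>\<^sub>F \<epsilon> in at_right 0. \<bar>x \<epsilon> - y \<epsilon>\<bar> + \<rho> \<epsilon> ^ Suc q \<le> \<rho> \<epsilon> ^ q"
  proof eventually_elim
    case (elim \<epsilon>)
    then show ?case
      using power_add2_quarter[of "\<rho> \<epsilon>" q] power_Suc_half[of "\<rho> \<epsilon>" q] by linarith
  qed
  then have "\<exists>k. \<forall>\<^sub>F \<epsilon> in at_right 0. \<bar>x \<epsilon> - y \<epsilon>\<bar> + \<rho> \<epsilon> ^ k \<le> \<rho> \<epsilon> ^ q" by (rule exI)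
  with m show ?thesis by (simp add: class_simps less_class_iff moderate_intros)
qed

lemma rc_d_power_closed [simp]: "rc_d \<rho> [^]\<^bsub>RC \<rho>\<^esub> (q::nat) \<in> carrier (RC \<rho>)"
  by (simp add: class_rc_d_power moderate_intros)

lemma rc_d_power_pos: "rc_less \<rho> \<zero>\<^bsub>RC \<rho>\<^esub> (rc_d \<rho> [^]\<^bsub>RC \<rho>\<^esub> (q::nat))"
  by (simp add: class_zero class_rc_d_power less_class_iff moderate_intros) (auto intro!: exI[of _ q])

subsection \<open>The sharp topology\<close>

lemma sharp_ball_open:
  "X \<in> carrier (RC \<rho>) \<Longrightarrow> openin (sharp_topology \<rho>) (sharp_ball \<rho> (rc_d \<rho> [^]\<^bsub>RC \<rho>\<^esub> (q::nat)) X)"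
  unfolding sharp_topology_def openin_topology_generated_by_iff
  by (rule generate_topology_on.Basis) (use rc_d_power_closed rc_d_power_pos in blast)

lemma sharp_ball_approx:
  assumes "Y \<in> sharp_ball \<rho> (rc_d \<rho> [^]\<^bsub>RC \<rho>\<^esub> (q::nat)) X" "X \<in> carrier (RC \<rho>)"
  shows "approx_le q X Y" "approx_le q Y X"
  using assms abs_diff_less_imp_approx_le unfolding sharp_ball_def by auto

lemma mem_sharp_ball:
  "X \<in> carrier (RC \<rho>) \<Longrightarrow> X \<in> sharp_ball \<rho> (rc_d \<rho> [^]\<^bsub>RC \<rho>\<^esub> (q::nat)) X"
  unfolding sharp_ball_def
  by (simp add: approx_le_imp_abs_diff_less le_imp_approx_le le_refl)

lemma topspace_sharp_topology: "topspace (sharp_topology \<rho>) = carrier (RC \<rho>)"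
proof
  show "topspace (sharp_topology \<rho>) \<subseteq> carrier (RC \<rho>)"
    by (auto simp: sharp_topology_def topology_generated_by_topspace sharp_ball_def)
  show "carrier (RC \<rho>) \<subseteq> topspace (sharp_topology \<rho>)"
    using mem_sharp_ball[of _ 0] openin_subset[OF sharp_ball_open[of _ 0]] by blast
qed

lemma openin_sharp_topologyD:
  assumes "openin (sharp_topology \<rho>) U" "X \<in> U"
  shows "\<exists>q. \<forall>Y. approx_le q X Y \<longrightarrow> approx_le q Y X \<longrightarrow> Y \<in> U"
  using assms unfolding sharp_topology_def openin_topology_generated_by_iff
proof (induction arbitrary: X rule: generate_topology_on.induct)
  case (Int a b)
  then obtain q q' where "\<And>Y. approx_le q X Y \<Longrightarrow> approx_le q Y X \<Longrightarrow> Y \<in> a"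
    "\<And>Y. approx_le q' X Y \<Longrightarrow> approx_le q' Y X \<Longrightarrow> Y \<in> b" by blast
  then show ?case
    by (intro exI[of _ "q + q'"]) (meson IntI approx_le_antimono le_add1 le_add2)
next
  case (UN K)
  then show ?case by blast
next
  case (Basis s)
  then obtain R Z where s: "s = sharp_ball \<rho> R Z" "R \<in> carrier (RC \<rho>)" "Z \<in> carrier (RC \<rho>)"
    by blast
  then have XZ: "X \<in> carrier (RC \<rho>)" "rc_less \<rho> (rc_abs \<rho> (X \<ominus>\<^bsub>RC \<rho>\<^esub> Z)) R"
    using Basis by (auto simp: sharp_ball_def)
  obtain x z r where m: "x \<in> mnets" "X = cl x" "z \<in> mnets" "Z = cl z" "r \<in> mnets" "R = cl r"
    using s XZ by (metis class_cases)
  obtain k where k: "\<forall>\<^sub>F \<epsilon> in at_right 0. \<bar>x \<epsilon> - z \<epsilon>\<bar> + \<rho> \<epsilon> ^ k \<le> r \<epsilon>"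
    using XZ m by (auto simp: class_simps less_class_iff moderate_intros)
  \<comment> \<open>Moving by \<open>2 * \<rho> \<epsilon> ^ (k + 2)\<close> consumes at most half
    of the gap \<open>\<rho> \<epsilon> ^ k\<close>, so \<open>\<rho> \<epsilon> ^ Suc k\<close> is
    left for strictness.\<close>
  have "Y \<in> s" if Y: "approx_le (k + 2) X Y" "approx_le (k + 2) Y X" for Y
  proof -
    obtain y where y: "y \<in> mnets" "Y = cl y"
      using approx_le_carrierD(2)[OF Y(1)] by (rule class_cases)
    have "\<forall>\<^sub>F \<epsilon> in at_right 0. x \<epsilon> \<le> y \<epsilon> + 2 * \<rho> \<epsilon> ^ (k + 2)"
      "\<forall>\<^sub>F \<epsilon> in at_right 0. y \<epsilon> \<le> x \<epsilon> + 2 * \<rho> \<epsilon> ^ (k + 2)"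
      by (rule approx_le_classD; use Y m y in blast)+
    with eventually_small k have "\<forall>\<^sub>F \<epsilon> in at_right 0. \<bar>y \<epsilon> - z \<epsilon>\<bar> + \<rho> \<epsilon> ^ Suc k \<le> r \<epsilon>"
    proof eventually_elim
      case (elim \<epsilon>)
      then show ?case
        using power_add2_quarter[of "\<rho> \<epsilon>" k] power_Suc_half[of "\<rho> \<epsilon>" k] by linarith
    qed
    then have "\<exists>k. \<forall>\<^sub>F \<epsilon> in at_right 0. \<bar>y \<epsilon> - z \<epsilon>\<bar> + \<rho> \<epsilon> ^ k \<le> r \<epsilon>" by (rule exI)
    then show ?thesis
      using m y s by (simp add: sharp_ball_def class_simps less_class_iff moderate_intros)
  qed
  then show ?case by blast
qed auto

lemma in_sharp_closure_iff:
  assumes "X \<in> carrier (RC \<rho>)"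
  shows "X \<in> sharp_topology \<rho> closure_of S \<longleftrightarrow> (\<forall>q. \<exists>Y\<in>S. approx_le q X Y \<and> approx_le q Y X)"
proof
  assume X: "X \<in> sharp_topology \<rho> closure_of S"
  show "\<forall>q. \<exists>Y\<in>S. approx_le q X Y \<and> approx_le q Y X"
  proof
    fix q :: nat
    obtain Y where "Y \<in> S" "Y \<in> sharp_ball \<rho> (rc_d \<rho> [^]\<^bsub>RC \<rho>\<^esub> q) X"
      using X sharp_ball_open[OF assms, of q] mem_sharp_ball[OF assms, of q]
      unfolding in_closure_of by blast
    then show "\<exists>Y\<in>S. approx_le q X Y \<and> approx_le q Y X"
      using sharp_ball_approx[OF _ assms] by blast
  qed
next
  assume "\<forall>q. \<exists>Y\<in>S. approx_le q X Y \<and> approx_le q Y X"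
  then have "\<exists>Y. Y \<in> S \<and> Y \<in> U" if "X \<in> U" "openin (sharp_topology \<rho>) U" for U
    using openin_sharp_topologyD[OF that(2,1)] by blast
  then show "X \<in> sharp_topology \<rho> closure_of S"
    using assms unfolding in_closure_of topspace_sharp_topology by blast
qed

text \<open>Balls whose radius is a power of \<open>rc_d \<rho>\<close> are open and, by
  \<open>openin_sharp_topologyD\<close>, fine enough to detect convergence.\<close>

lemma limitin_sharp_iff:
  assumes "X \<in> carrier (RC \<rho>)"
  shows "limitin (sharp_topology \<rho>) f X F \<longleftrightarrow>
    (\<forall>q. \<forall>\<^sub>F j in F. approx_le q X (f j) \<and> approx_le q (f j) X)"
proof
  assume lim: "limitin (sharp_topology \<rho>) f X F"
  show "\<forall>q. \<forall>\<^sub>F j in F. approx_le q X (f j) \<and> approx_le q (f j) X"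
  proof
    fix q :: nat
    have "\<forall>\<^sub>F j in F. f j \<in> sharp_ball \<rho> (rc_d \<rho> [^]\<^bsub>RC \<rho>\<^esub> q) X"
      using lim sharp_ball_open[OF assms] mem_sharp_ball[OF assms] unfolding limitin_def by blast
    then show "\<forall>\<^sub>F j in F. approx_le q X (f j) \<and> approx_le q (f j) X"
      by eventually_elim (simp add: sharp_ball_approx[OF _ assms])
  qed
next
  assume ev: "\<forall>q. \<forall>\<^sub>F j in F. approx_le q X (f j) \<and> approx_le q (f j) X"
  show "limitin (sharp_topology \<rho>) f X F"
    unfolding limitin_def topspace_sharp_topology
  proof (intro conjI allI impI assms)
    fix U assume "openin (sharp_topology \<rho>) U \<and> X \<in> U"
    then obtain q where "\<forall>Y. approx_le q X Y \<longrightarrow> approx_le q Y X \<longrightarrow> Y \<in> U"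
      using openin_sharp_topologyD by blast
    then show "\<forall>\<^sub>F j in F. f j \<in> U"
      using ev[THEN spec, of q] by (auto elim: eventually_mono)
  qed
qed

subsection \<open>Hypernatural numbers\<close>

text \<open>The values of a representative outside \<open>{0<..1}\<close> are arbitrary reals, hence
  nonnegativity only near 0.\<close>

lemma hypernat_cases:
  assumes "n \<in> hypernat \<rho>"
  obtains f where "f \<in> mnets" "n = cl f" "\<forall>\<^sub>F \<epsilon> in at_right 0. 0 \<le> f \<epsilon>" "\<And>\<epsilon>. \<epsilon> \<in> {0<..1} \<Longrightarrow> f \<epsilon> \<in> \<nat>"
proof -
  obtain f where f: "f \<in> mnets" "n = cl f" "\<forall>\<epsilon>\<in>{0<..1}. f \<epsilon> \<in> \<nat>"
    using assms by (auto simp: hypernat_def)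
  have "\<forall>\<^sub>F \<epsilon> in at_right (0::real). \<epsilon> \<in> {0<..1}"
    unfolding eventually_at_right_field by (intro exI[of _ 1]) auto
  then have "\<forall>\<^sub>F \<epsilon> in at_right 0. 0 \<le> f \<epsilon>"
    by eventually_elim (use f(3) Nats_altdef2 in auto)
  with f show thesis by (intro that) auto
qed

lemma hypernat_closed: "n \<in> hypernat \<rho> \<Longrightarrow> n \<in> carrier (RC \<rho>)"
  by (erule hypernat_cases) simp

text \<open>In a partial order neither number need be an upper bound of both, but the sum plus one
  is strictly above each: the gap 1 is the zeroth power of the gauge. This gives directedness of the
  tails and room for strictly increasing sequences.\<close>

lemma hypernat_upper:
  assumes "n \<in> hypernat \<rho>" "m \<in> hypernat \<rho>"
  shows "\<exists>k\<in>hypernat \<rho>. rc_less \<rho> n k \<and> rc_less \<rho> m k"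
proof -
  obtain f where f: "f \<in> mnets" "n = cl f" "\<forall>\<^sub>F \<epsilon> in at_right 0. 0 \<le> f \<epsilon>" "\<And>\<epsilon>. \<epsilon> \<in> {0<..1} \<Longrightarrow> f \<epsilon> \<in> \<nat>"
    using assms(1) by (rule hypernat_cases) blast
  obtain g where g: "g \<in> mnets" "m = cl g" "\<forall>\<^sub>F \<epsilon> in at_right 0. 0 \<le> g \<epsilon>" "\<And>\<epsilon>. \<epsilon> \<in> {0<..1} \<Longrightarrow> g \<epsilon> \<in> \<nat>"
    using assms(2) by (rule hypernat_cases) blast
  let ?h = "\<lambda>\<epsilon>. (f \<epsilon> + g \<epsilon>) + 1"
  have h: "?h \<in> mnets" using f g by (intro moderate_intros)
  have "\<forall>\<^sub>F \<epsilon> in at_right 0. f \<epsilon> + \<rho> \<epsilon> ^ 0 \<le> ?h \<epsilon>"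
    using g(3) by eventually_elim simp
  then have "rc_less \<rho> n (cl ?h)" unfolding f(2) less_class_iff[OF f(1) h] by (rule exI)
  moreover have "\<forall>\<^sub>F \<epsilon> in at_right 0. g \<epsilon> + \<rho> \<epsilon> ^ 0 \<le> ?h \<epsilon>"
    using f(3) by eventually_elim simp
  then have "rc_less \<rho> m (cl ?h)" unfolding g(2) less_class_iff[OF g(1) h] by (rule exI)
  moreover have "cl ?h \<in> hypernat \<rho>"
    unfolding hypernat_def using h f(4) g(4) by (intro CollectI exI[of _ ?h]) auto
  ultimately show ?thesis by blast
qed

lemma less_imp_le: "rc_less \<rho> X Y \<Longrightarrow> rc_le \<rho> X Y"
  by (simp add: rc_less_def)

lemma inv_rc_d_power: "inv\<^bsub>RC \<rho>\<^esub> (rc_d \<rho> [^]\<^bsub>RC \<rho>\<^esub> (q::nat)) = cl (\<lambda>\<epsilon>. inverse (\<rho> \<epsilon>) ^ q)"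
proof (rule RC.comm_inv_char)
  have "cl (\<lambda>\<epsilon>. \<rho> \<epsilon> ^ q * inverse (\<rho> \<epsilon>) ^ q) = cl (\<lambda>\<epsilon>. 1)"
  proof (rule class_eqI_eventually)
    show "\<forall>\<^sub>F \<epsilon> in at_right 0. \<rho> \<epsilon> ^ q * inverse (\<rho> \<epsilon>) ^ q = 1"
      using eventually_small by eventually_elim (simp flip: power_mult_distrib)
  qed (intro moderate_intros)+
  then show "rc_d \<rho> [^]\<^bsub>RC \<rho>\<^esub> q \<otimes>\<^bsub>RC \<rho>\<^esub> cl (\<lambda>\<epsilon>. inverse (\<rho> \<epsilon>) ^ q) = \<one>\<^bsub>RC \<rho>\<^esub>"
    by (simp add: class_simps moderate_intros)
qed (simp_all add: moderate_intros)

text \<open>Rounding up the \<open>q\<close>-th power of the reciprocal gauge keeps it moderate, and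
  adding 1 creates the gap for strictness. The bound covers all \<open>p \<le> q\<close> at once so
  that a sequence with such a bound at each stage \<open>q\<close> tends to infinity.\<close>

lemma hypernat_above_inv_rc_d_power:
  "\<exists>k\<in>hypernat \<rho>. \<forall>p\<le>q. rc_less \<rho> (inv\<^bsub>RC \<rho>\<^esub> (rc_d \<rho> [^]\<^bsub>RC \<rho>\<^esub> (p::nat))) k"
proof -
  let ?c = "\<lambda>\<epsilon>. real (nat \<lceil>inverse (\<rho> \<epsilon>) ^ q\<rceil>)"
  let ?h = "\<lambda>\<epsilon>. ?c \<epsilon> + 1"
  have "(\<lambda>\<epsilon>. inverse (\<rho> \<epsilon>) ^ q + 1) \<in> mnets" by (intro moderate_intros)
  then obtain N :: nat where N: "\<forall>\<^sub>F \<epsilon> in at_right 0. \<bar>inverse (\<rho> \<epsilon>) ^ q + 1\<bar> \<le> \<rho> \<epsilon> powi (- int N)"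
    by (auto simp: moderate_def)
  have "\<forall>\<^sub>F \<epsilon> in at_right 0. \<bar>?c \<epsilon>\<bar> \<le> \<rho> \<epsilon> powi (- int N)"
    using N eventually_small
  proof eventually_elim
    case (elim \<epsilon>)
    then have "0 \<le> inverse (\<rho> \<epsilon>) ^ q" by simp
    then have "\<bar>?c \<epsilon>\<bar> \<le> inverse (\<rho> \<epsilon>) ^ q + 1" by linarith
    then show ?case using elim by linarith
  qed
  then have "?c \<in> mnets" unfolding moderate_def by blast
  then have h: "?h \<in> mnets" by (intro moderate_intros)
  have "rc_less \<rho> (inv\<^bsub>RC \<rho>\<^esub> (rc_d \<rho> [^]\<^bsub>RC \<rho>\<^esub> p)) (cl ?h)" if "p \<le> q" for p :: nat
  proof -
    have "\<forall>\<^sub>F \<epsilon> in at_right 0. inverse (\<rho> \<epsilon>) ^ p + \<rho> \<epsilon> ^ 0 \<le> ?h \<epsilon>"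
      using eventually_small
    proof eventually_elim
      case (elim \<epsilon>)
      then have "1 \<le> inverse (\<rho> \<epsilon>)" by (simp add: one_le_inverse_iff)
      then have "inverse (\<rho> \<epsilon>) ^ p \<le> inverse (\<rho> \<epsilon>) ^ q" using that by (rule power_increasing[rotated])
      moreover have "inverse (\<rho> \<epsilon>) ^ q \<le> ?c \<epsilon>" by linarith
      ultimately show ?case by simp
    qed
    then show ?thesis
      unfolding inv_rc_d_power less_class_iff[OF moderate_inverse_power h] by (rule exI)
  qed
  moreover have "cl ?h \<in> hypernat \<rho>"
    unfolding hypernat_def using h by (intro CollectI exI[of _ ?h]) auto
  ultimately show ?thesis by blast
qed

text \<open>Moderateness is already the required bound. Hence the powers in
  \<open>tends_to_infinity\<close> are cofinal among the hypernaturals, and a sequence tending to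
  infinity eventually passes each of them.\<close>

lemma hypernat_le_inv_rc_d_power:
  assumes "n \<in> hypernat \<rho>"
  shows "\<exists>p::nat. rc_le \<rho> n (inv\<^bsub>RC \<rho>\<^esub> (rc_d \<rho> [^]\<^bsub>RC \<rho>\<^esub> p))"
proof -
  obtain f where f: "f \<in> mnets" "n = cl f" using hypernat_closed[OF assms] by (rule class_cases)
  obtain N :: nat where N: "\<forall>\<^sub>F \<epsilon> in at_right 0. \<bar>f \<epsilon>\<bar> \<le> \<rho> \<epsilon> powi (- int N)"
    using f(1) by (auto simp: moderate_def)
  have "\<forall>\<^sub>F \<epsilon> in at_right 0. f \<epsilon> \<le> inverse (\<rho> \<epsilon>) ^ N + \<rho> \<epsilon> ^ q" for q
    using N eventually_small
  proof eventually_elim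
    case (elim \<epsilon>)
    then have "0 \<le> \<rho> \<epsilon> ^ q" by simp
    moreover have "\<bar>f \<epsilon>\<bar> \<le> inverse (\<rho> \<epsilon>) ^ N"
      using elim by (simp add: power_int_minus power_inverse)
    ultimately show ?case by linarith
  qed
  then have "rc_le \<rho> n (inv\<^bsub>RC \<rho>\<^esub> (rc_d \<rho> [^]\<^bsub>RC \<rho>\<^esub> N))"
    by (simp add: f inv_rc_d_power le_class_iff moderate_intros)
  then show ?thesis ..
qed

lemma hypernat_ge_iff: "n \<in> hypernat_ge \<rho> m \<longleftrightarrow> n \<in> hypernat \<rho> \<and> rc_le \<rho> m n"
  by (simp add: hypernat_ge_def)

text \<open>The order depends on the gauge and lives on a set of classes, so the filter is assembled
  from its tails. The quantifier patterns of the limit definitions then become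
  \<open>eventually\<close> and \<open>frequently\<close>.\<close>

definition hypernat_at_top :: "gnum filter" where
  "hypernat_at_top = (INF N\<in>hypernat \<rho>. principal (hypernat_ge \<rho> N))"

lemma eventually_hypernat_at_top:
  "eventually P hypernat_at_top \<longleftrightarrow> (\<exists>N\<in>hypernat \<rho>. \<forall>n\<in>hypernat_ge \<rho> N. P n)"
  unfolding hypernat_at_top_def
proof (subst eventually_INF_base)
  show "hypernat \<rho> \<noteq> {}" using hypernat_above_inv_rc_d_power by blast
next
  fix n m assume "n \<in> hypernat \<rho>" "m \<in> hypernat \<rho>"
  then obtain k where "k \<in> hypernat \<rho>" "rc_le \<rho> n k" "rc_le \<rho> m k"
    using hypernat_upper less_imp_le by blast
  then show "\<exists>k\<in>hypernat \<rho>. principal (hypernat_ge \<rho> k) \<le>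
      inf (principal (hypernat_ge \<rho> n)) (principal (hypernat_ge \<rho> m))"
    by (intro bexI[of _ k]) (auto simp: hypernat_ge_iff intro: le_trans)
qed (simp add: eventually_principal)

lemma frequently_hypernat_at_top:
  "frequently P hypernat_at_top \<longleftrightarrow> (\<forall>N\<in>hypernat \<rho>. \<exists>n\<in>hypernat_ge \<rho> N. P n)"
  by (simp add: frequently_def eventually_hypernat_at_top)

text \<open>Each tail contains its own starting point. The consequence used later is that eventual
  properties are frequent.\<close>

lemma hypernat_at_top_neq_bot: "hypernat_at_top \<noteq> bot"
proof -
  have "\<exists>\<^sub>F n in hypernat_at_top. True"
    unfolding frequently_hypernat_at_top using le_refl hypernat_closed by (auto simp: hypernat_ge_iff)
  then show ?thesis by (metis eventually_bot frequently_def)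
qed

lemma eventually_hypernat: "\<forall>\<^sub>F n in hypernat_at_top. n \<in> hypernat \<rho>"
  unfolding eventually_hypernat_at_top using hypernat_above_inv_rc_d_power by (auto simp: hypernat_ge_iff)

lemma eventually_ge_hypernat_at_top: "N \<in> hypernat \<rho> \<Longrightarrow> \<forall>\<^sub>F n in hypernat_at_top. n \<in> hypernat_ge \<rho> N"
  unfolding eventually_hypernat_at_top by blast

lemma increasing_sequence_le:
  assumes "\<And>q. k q \<in> hypernat \<rho>" "\<And>q. rc_less \<rho> (k q) (k (Suc q))" "p \<le> (q::nat)"
  shows "rc_le \<rho> (k p) (k q)"
  using assms(3)
proof (induction q rule: dec_induct)
  case base
  show ?case by (intro le_refl hypernat_closed assms)
next
  case (step q)
  then show ?case using le_trans less_imp_le[OF assms(2)] by blast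
qed

text \<open>Membership in the closure asks for approximation from both sides; one side is already
  implied by the upper bound property.\<close>

lemma is_sharp_sup_iff:
  assumes "S \<subseteq> carrier (RC \<rho>)"
  shows "is_sharp_sup \<rho> S s \<longleftrightarrow>
    s \<in> carrier (RC \<rho>) \<and> (\<forall>a\<in>S. rc_le \<rho> a s) \<and> (\<forall>q. \<exists>a\<in>S. approx_le q s a)"
  unfolding is_sharp_sup_def using in_sharp_closure_iff[of s S] le_imp_approx_le by blast

lemma is_sharp_inf_iff:
  assumes "S \<subseteq> carrier (RC \<rho>)"
  shows "is_sharp_inf \<rho> S s \<longleftrightarrow>
    s \<in> carrier (RC \<rho>) \<and> (\<forall>a\<in>S. rc_le \<rho> s a) \<and> (\<forall>q. \<exists>a\<in>S. approx_le q a s)"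
  unfolding is_sharp_inf_def using in_sharp_closure_iff[of s S] le_imp_approx_le by blast

lemma le_approx_trans: "rc_le \<rho> X Y \<Longrightarrow> approx_le (q + 2) Y Z \<Longrightarrow> approx_le q X Z"
  using approx_le_trans le_imp_approx_le by blast

lemma approx_le_le_trans: "approx_le (q + 2) X Y \<Longrightarrow> rc_le \<rho> Y Z \<Longrightarrow> approx_le q X Z"
  using approx_le_trans le_imp_approx_le by blast

end

subsection \<open>Limits superior and inferior\<close>

locale two_gauges = gauge \<rho> + S: gauge \<sigma> for \<rho> \<sigma>
begin

lemma hyperseqsD: "x \<in> hyperseqs \<sigma> \<rho> \<Longrightarrow> n \<in> hypernat \<sigma> \<Longrightarrow> x n \<in> carrier (RC \<rho>)"
  by (auto simp: hyperseqs_def)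

lemma eventually_hyperseq_cong:
  assumes "\<And>n. n \<in> hypernat \<sigma> \<Longrightarrow> P n \<longleftrightarrow> Q n"
  shows "(\<forall>\<^sub>F n in S.hypernat_at_top. P n) \<longleftrightarrow> (\<forall>\<^sub>F n in S.hypernat_at_top. Q n)"
    and "(\<exists>\<^sub>F n in S.hypernat_at_top. P n) \<longleftrightarrow> (\<exists>\<^sub>F n in S.hypernat_at_top. Q n)"
  using eventually_cong[OF S.eventually_hypernat assms] frequently_cong[OF S.eventually_hypernat assms]
  by simp_all

lemma is_limsup_iff:
  assumes "x \<in> hyperseqs \<sigma> \<rho>"
  shows "is_limsup \<sigma> \<rho> x \<iota> \<longleftrightarrow> \<iota> \<in> carrier (RC \<rho>) \<and>
    (\<forall>q. \<forall>\<^sub>F n in S.hypernat_at_top. approx_le q (x n) \<iota>) \<and>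
    (\<forall>q. \<exists>\<^sub>F n in S.hypernat_at_top. approx_le q \<iota> (x n))"
proof (cases "\<iota> \<in> carrier (RC \<rho>)")
  case True
  have "(\<forall>\<^sub>F n in S.hypernat_at_top. approx_le q (x n) \<iota>) \<longleftrightarrow>
      (\<forall>\<^sub>F n in S.hypernat_at_top. rc_le \<rho> (x n) (\<iota> \<oplus>\<^bsub>RC \<rho>\<^esub> rc_d \<rho> [^]\<^bsub>RC \<rho>\<^esub> q))" for q
    by (rule eventually_hyperseq_cong) (use True assms in \<open>auto simp: approx_le_def hyperseqsD\<close>)
  moreover have "(\<exists>\<^sub>F n in S.hypernat_at_top. approx_le q \<iota> (x n)) \<longleftrightarrow>
      (\<exists>\<^sub>F n in S.hypernat_at_top. rc_le \<rho> (\<iota> \<ominus>\<^bsub>RC \<rho>\<^esub> rc_d \<rho> [^]\<^bsub>RC \<rho>\<^esub> q) (x n))" for q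
    by (rule eventually_hyperseq_cong) (use True assms in \<open>auto simp: approx_le_diff_iff hyperseqsD\<close>)
  ultimately show ?thesis
    using True by (simp add: is_limsup_def S.eventually_hypernat_at_top S.frequently_hypernat_at_top)
qed (simp add: is_limsup_def)

lemma is_liminf_iff:
  assumes "x \<in> hyperseqs \<sigma> \<rho>"
  shows "is_liminf \<sigma> \<rho> x \<tau> \<longleftrightarrow> \<tau> \<in> carrier (RC \<rho>) \<and>
    (\<forall>q. \<forall>\<^sub>F n in S.hypernat_at_top. approx_le q \<tau> (x n)) \<and>
    (\<forall>q. \<exists>\<^sub>F n in S.hypernat_at_top. approx_le q (x n) \<tau>)"
proof (cases "\<tau> \<in> carrier (RC \<rho>)")
  case True
  have "(\<exists>\<^sub>F n in S.hypernat_at_top. approx_le q (x n) \<tau>) \<longleftrightarrow>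
      (\<exists>\<^sub>F n in S.hypernat_at_top. rc_le \<rho> (x n) (\<tau> \<oplus>\<^bsub>RC \<rho>\<^esub> rc_d \<rho> [^]\<^bsub>RC \<rho>\<^esub> q))" for q
    by (rule eventually_hyperseq_cong) (use True assms in \<open>auto simp: approx_le_def hyperseqsD\<close>)
  moreover have "(\<forall>\<^sub>F n in S.hypernat_at_top. approx_le q \<tau> (x n)) \<longleftrightarrow>
      (\<forall>\<^sub>F n in S.hypernat_at_top. rc_le \<rho> (\<tau> \<ominus>\<^bsub>RC \<rho>\<^esub> rc_d \<rho> [^]\<^bsub>RC \<rho>\<^esub> q) (x n))" for q
    by (rule eventually_hyperseq_cong) (use True assms in \<open>auto simp: approx_le_diff_iff hyperseqsD\<close>)
  ultimately show ?thesis
    using True by (simp add: is_liminf_def S.eventually_hypernat_at_top S.frequently_hypernat_at_top)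
qed (simp add: is_liminf_def)

lemma is_hyperlim_iff:
  assumes "x \<in> hyperseqs \<sigma> \<rho>"
  shows "is_hyperlim \<sigma> \<rho> x l \<longleftrightarrow> l \<in> carrier (RC \<rho>) \<and>
    (\<forall>q. \<forall>\<^sub>F n in S.hypernat_at_top. approx_le q (x n) l \<and> approx_le q l (x n))"
    (is "_ \<longleftrightarrow> _ \<and> ?R")
proof (cases "l \<in> carrier (RC \<rho>)")
  case True
  let ?P = "\<lambda>q n. rc_less \<rho> (rc_abs \<rho> (x n \<ominus>\<^bsub>RC \<rho>\<^esub> l)) (rc_d \<rho> [^]\<^bsub>RC \<rho>\<^esub> (q::nat))"
  \<comment> \<open>The equivalence is stated for all \<open>q\<close> together because recovering
    the strict inequality costs two powers.\<close>
  have "(\<forall>q. \<forall>\<^sub>F n in S.hypernat_at_top. ?P q n) \<longleftrightarrow> ?R"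
  proof
    assume L: "\<forall>q. \<forall>\<^sub>F n in S.hypernat_at_top. ?P q n"
    show ?R
    proof
      fix q
      show "\<forall>\<^sub>F n in S.hypernat_at_top. approx_le q (x n) l \<and> approx_le q l (x n)"
        using L[THEN spec, of q] S.eventually_hypernat
        by eventually_elim (use abs_diff_less_imp_approx_le True assms hyperseqsD in blast)
    qed
  next
    assume R: ?R
    show "\<forall>q. \<forall>\<^sub>F n in S.hypernat_at_top. ?P q n"
    proof
      fix q
      show "\<forall>\<^sub>F n in S.hypernat_at_top. ?P q n"
        using R[THEN spec, of "q + 2"] by eventually_elim (simp add: approx_le_imp_abs_diff_less)
    qed
  qed
  then show ?thesis using True by (simp add: is_hyperlim_def S.eventually_hypernat_at_top)
qed (simp add: is_hyperlim_def)

text \<open>At an index where both estimates hold, the term of the sequence links \<open>X\<close>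
  to \<open>Y\<close>. This is the common source of uniqueness, of the estimates for sums and
  products, and of the comparison with suprema of tails.\<close>

lemma le_if_frequently_eventually:
  assumes "\<And>q. \<exists>\<^sub>F n in S.hypernat_at_top. approx_le q X (x n)"
    and "\<And>q. \<forall>\<^sub>F n in S.hypernat_at_top. approx_le q (x n) Y"
  shows "rc_le \<rho> X Y"
proof (rule le_if_approx_le)
  fix q
  have "\<exists>\<^sub>F n in S.hypernat_at_top. approx_le (q + 2) X (x n) \<and> approx_le (q + 2) (x n) Y"
    by (intro frequently_eventually_frequently assms)
  then obtain n where "approx_le (q + 2) X (x n)" "approx_le (q + 2) (x n) Y"
    by (blast dest: frequently_ex)
  then show "approx_le q X Y" by (rule approx_le_trans)
qed

lemma limsup_unique:
  assumes "x \<in> hyperseqs \<sigma> \<rho>" "is_limsup \<sigma> \<rho> x \<iota>" "is_limsup \<sigma> \<rho> x \<kappa>"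
  shows "\<iota> = \<kappa>"
  by (rule le_antisym; rule le_if_frequently_eventually[of _ x]) (use assms is_limsup_iff in auto)

lemma hyperseqs_uminus: "x \<in> hyperseqs \<sigma> \<rho> \<Longrightarrow> (\<lambda>n. \<ominus>\<^bsub>RC \<rho>\<^esub> x n) \<in> hyperseqs \<sigma> \<rho>"
  and hyperseqs_add: "x \<in> hyperseqs \<sigma> \<rho> \<Longrightarrow> y \<in> hyperseqs \<sigma> \<rho> \<Longrightarrow> (\<lambda>n. x n \<oplus>\<^bsub>RC \<rho>\<^esub> y n) \<in> hyperseqs \<sigma> \<rho>"
  and hyperseqs_mult: "x \<in> hyperseqs \<sigma> \<rho> \<Longrightarrow> y \<in> hyperseqs \<sigma> \<rho> \<Longrightarrow> (\<lambda>n. x n \<otimes>\<^bsub>RC \<rho>\<^esub> y n) \<in> hyperseqs \<sigma> \<rho>"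
  by (auto simp: hyperseqs_def Pi_iff)

text \<open>Negation reverses \<open>approx_le\<close> without changing the exponent, so the two
  conditions correspond one by one. Uniqueness of the limit inferior is inherited through
  this.\<close>

lemma limsup_uminus_iff:
  assumes x: "x \<in> hyperseqs \<sigma> \<rho>" and \<tau>: "\<tau> \<in> carrier (RC \<rho>)"
  shows "is_limsup \<sigma> \<rho> (\<lambda>n. \<ominus>\<^bsub>RC \<rho>\<^esub> x n) (\<ominus>\<^bsub>RC \<rho>\<^esub> \<tau>) \<longleftrightarrow> is_liminf \<sigma> \<rho> x \<tau>"
proof -
  have "(\<forall>\<^sub>F n in S.hypernat_at_top. approx_le q (\<ominus>\<^bsub>RC \<rho>\<^esub> x n) (\<ominus>\<^bsub>RC \<rho>\<^esub> \<tau>)) \<longleftrightarrow>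
      (\<forall>\<^sub>F n in S.hypernat_at_top. approx_le q \<tau> (x n))" for q
    by (rule eventually_hyperseq_cong) (use x \<tau> in \<open>simp add: approx_le_uminus_iff hyperseqsD\<close>)
  moreover have "(\<exists>\<^sub>F n in S.hypernat_at_top. approx_le q (\<ominus>\<^bsub>RC \<rho>\<^esub> \<tau>) (\<ominus>\<^bsub>RC \<rho>\<^esub> x n)) \<longleftrightarrow>
      (\<exists>\<^sub>F n in S.hypernat_at_top. approx_le q (x n) \<tau>)" for q
    by (rule eventually_hyperseq_cong) (use x \<tau> in \<open>simp add: approx_le_uminus_iff hyperseqsD\<close>)
  ultimately show ?thesis
    by (simp add: is_limsup_iff[OF hyperseqs_uminus[OF x]] is_liminf_iff[OF x] \<tau>)
qed

lemma limsup_carrierD: "is_limsup \<sigma> \<rho> x \<iota> \<Longrightarrow> \<iota> \<in> carrier (RC \<rho>)"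
  and liminf_carrierD: "is_liminf \<sigma> \<rho> x \<iota> \<Longrightarrow> \<iota> \<in> carrier (RC \<rho>)"
  by (simp_all add: is_limsup_def is_liminf_def)

lemma liminf_unique:
  assumes "x \<in> hyperseqs \<sigma> \<rho>" "is_liminf \<sigma> \<rho> x \<iota>" "is_liminf \<sigma> \<rho> x \<kappa>"
  shows "\<iota> = \<kappa>"
proof -
  have c: "\<iota> \<in> carrier (RC \<rho>)" "\<kappa> \<in> carrier (RC \<rho>)" using assms(2,3) by (auto dest: liminf_carrierD)
  have "\<ominus>\<^bsub>RC \<rho>\<^esub> \<iota> = \<ominus>\<^bsub>RC \<rho>\<^esub> \<kappa>"
    by (rule limsup_unique[OF hyperseqs_uminus[OF assms(1)]])
      (simp_all add: limsup_uminus_iff assms c)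
  with c show ?thesis by (metis RC.minus_minus)
qed

lemma limsup_uminus_ex_iff:
  assumes x: "x \<in> hyperseqs \<sigma> \<rho>"
  shows "(\<exists>\<iota>. is_limsup \<sigma> \<rho> (\<lambda>n. \<ominus>\<^bsub>RC \<rho>\<^esub> x n) \<iota>) \<longleftrightarrow> (\<exists>\<tau>. is_liminf \<sigma> \<rho> x \<tau>)"
proof
  assume "\<exists>\<iota>. is_limsup \<sigma> \<rho> (\<lambda>n. \<ominus>\<^bsub>RC \<rho>\<^esub> x n) \<iota>"
  then obtain \<iota> where \<iota>: "is_limsup \<sigma> \<rho> (\<lambda>n. \<ominus>\<^bsub>RC \<rho>\<^esub> x n) \<iota>" ..
  then have "is_liminf \<sigma> \<rho> x (\<ominus>\<^bsub>RC \<rho>\<^esub> \<iota>)"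
    using limsup_uminus_iff[OF x, of "\<ominus>\<^bsub>RC \<rho>\<^esub> \<iota>"] limsup_carrierD by simp
  then show "\<exists>\<tau>. is_liminf \<sigma> \<rho> x \<tau>" ..
next
  assume "\<exists>\<tau>. is_liminf \<sigma> \<rho> x \<tau>"
  then show "\<exists>\<iota>. is_limsup \<sigma> \<rho> (\<lambda>n. \<ominus>\<^bsub>RC \<rho>\<^esub> x n) \<iota>"
    using limsup_uminus_iff[OF x] liminf_carrierD by blast
qed

lemma limsup_uminus_eq:
  assumes x: "x \<in> hyperseqs \<sigma> \<rho>"
    and "is_limsup \<sigma> \<rho> (\<lambda>n. \<ominus>\<^bsub>RC \<rho>\<^esub> x n) \<iota>" "is_liminf \<sigma> \<rho> x \<tau>"
  shows "\<iota> = \<ominus>\<^bsub>RC \<rho>\<^esub> \<tau>"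
  using limsup_unique[OF hyperseqs_uminus[OF x] assms(2)] limsup_uminus_iff[OF x] liminf_carrierD assms(3)
  by blast

section \<open>Suprema of tails and their infimum\<close>

context
  fixes x \<alpha>
  assumes x: "x \<in> hyperseqs \<sigma> \<rho>"
    and \<alpha>: "\<And>m. m \<in> hypernat \<sigma> \<Longrightarrow> is_sharp_sup \<rho> (x ` hypernat_ge \<sigma> m) (\<alpha> m)"
begin

lemma tail_sup:
  assumes "m \<in> hypernat \<sigma>"
  shows "\<alpha> m \<in> carrier (RC \<rho>)" "\<And>n. n \<in> hypernat_ge \<sigma> m \<Longrightarrow> rc_le \<rho> (x n) (\<alpha> m)"
    "\<exists>n\<in>hypernat_ge \<sigma> m. approx_le q (\<alpha> m) (x n)"
proof -
  have "x ` hypernat_ge \<sigma> m \<subseteq> carrier (RC \<rho>)"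
    using x by (auto simp: S.hypernat_ge_iff hyperseqsD)
  from \<alpha>[OF assms, unfolded is_sharp_sup_iff[OF this]]
  show "\<alpha> m \<in> carrier (RC \<rho>)" "\<And>n. n \<in> hypernat_ge \<sigma> m \<Longrightarrow> rc_le \<rho> (x n) (\<alpha> m)"
    "\<exists>n\<in>hypernat_ge \<sigma> m. approx_le q (\<alpha> m) (x n)"
    by auto
qed

lemma tail_sup_hyperseq: "\<alpha> \<in> hyperseqs \<sigma> \<rho>"
  by (auto simp: hyperseqs_def tail_sup)

lemma tail_sup_inf_iff:
  "is_sharp_inf \<rho> (\<alpha> ` hypernat \<sigma>) a \<longleftrightarrow> a \<in> carrier (RC \<rho>) \<and>
    (\<forall>m\<in>hypernat \<sigma>. rc_le \<rho> a (\<alpha> m)) \<and> (\<forall>q. \<exists>m\<in>hypernat \<sigma>. approx_le q (\<alpha> m) a)"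
  by (subst is_sharp_inf_iff) (auto simp: tail_sup)

text \<open>Every \<open>\<alpha> m\<close> bounds a whole tail and is approximated by a term of
  that tail, so estimates pass between the terms and the \<open>\<alpha> m\<close> in both
  directions. The equivalence is for one and the same number, which settles existence and equality
  together.\<close>

lemma limsup_iff_inf_tail_sup: "is_limsup \<sigma> \<rho> x \<iota> \<longleftrightarrow> is_sharp_inf \<rho> (\<alpha> ` hypernat \<sigma>) \<iota>"
proof
  assume "is_limsup \<sigma> \<rho> x \<iota>"
  then have c: "\<iota> \<in> carrier (RC \<rho>)"
    and up: "\<And>q. \<forall>\<^sub>F n in S.hypernat_at_top. approx_le q (x n) \<iota>"
    and lo: "\<And>q. \<exists>\<^sub>F n in S.hypernat_at_top. approx_le q \<iota> (x n)"
    using is_limsup_iff[OF x] by auto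
  have "rc_le \<rho> \<iota> (\<alpha> m)" if m: "m \<in> hypernat \<sigma>" for m
  proof (rule le_if_frequently_eventually[OF lo])
    fix q
    show "\<forall>\<^sub>F n in S.hypernat_at_top. approx_le q (x n) (\<alpha> m)"
      using S.eventually_ge_hypernat_at_top[OF m]
      by eventually_elim (intro le_imp_approx_le tail_sup(2)[OF m])
  qed
  moreover have "\<exists>m\<in>hypernat \<sigma>. approx_le q (\<alpha> m) \<iota>" for q
  proof -
    obtain N where N: "N \<in> hypernat \<sigma>" "\<And>n. n \<in> hypernat_ge \<sigma> N \<Longrightarrow> approx_le (q + 2) (x n) \<iota>"
      using up[of "q + 2"] unfolding S.eventually_hypernat_at_top by blast
    obtain n where "n \<in> hypernat_ge \<sigma> N" "approx_le (q + 2) (\<alpha> N) (x n)"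
      using tail_sup(3)[OF N(1)] by blast
    with N show ?thesis using approx_le_trans by blast
  qed
  ultimately show "is_sharp_inf \<rho> (\<alpha> ` hypernat \<sigma>) \<iota>" using c tail_sup_inf_iff by blast
next
  assume "is_sharp_inf \<rho> (\<alpha> ` hypernat \<sigma>) \<iota>"
  then have c: "\<iota> \<in> carrier (RC \<rho>)" and lo: "\<And>m. m \<in> hypernat \<sigma> \<Longrightarrow> rc_le \<rho> \<iota> (\<alpha> m)"
    and up: "\<And>q. \<exists>m\<in>hypernat \<sigma>. approx_le q (\<alpha> m) \<iota>"
    by (auto simp: tail_sup_inf_iff)
  have "\<forall>\<^sub>F n in S.hypernat_at_top. approx_le q (x n) \<iota>" for q
  proof -
    obtain m where "m \<in> hypernat \<sigma>" "approx_le (q + 2) (\<alpha> m) \<iota>" using up by blast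
    then show ?thesis
      unfolding S.eventually_hypernat_at_top using le_approx_trans tail_sup(2) by blast
  qed
  moreover have "\<exists>\<^sub>F n in S.hypernat_at_top. approx_le q \<iota> (x n)" for q
    unfolding S.frequently_hypernat_at_top using le_approx_trans[OF lo] tail_sup(3) by meson
  ultimately show "is_limsup \<sigma> \<rho> x \<iota>" using c is_limsup_iff[OF x] by blast
qed

lemma hyperlim_tail_sup:
  assumes "is_limsup \<sigma> \<rho> x \<iota>"
  shows "is_hyperlim \<sigma> \<rho> \<alpha> \<iota>"
  unfolding is_hyperlim_iff[OF tail_sup_hyperseq]
proof (intro conjI allI)
  show "\<iota> \<in> carrier (RC \<rho>)" by (rule limsup_carrierD[OF assms])
  fix q
  have "\<forall>\<^sub>F n in S.hypernat_at_top. approx_le (q + 2) (x n) \<iota>"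
    using assms is_limsup_iff[OF x] by blast
  then obtain N where N: "N \<in> hypernat \<sigma>" "\<And>n. n \<in> hypernat_ge \<sigma> N \<Longrightarrow> approx_le (q + 2) (x n) \<iota>"
    unfolding S.eventually_hypernat_at_top by blast
  show "\<forall>\<^sub>F m in S.hypernat_at_top. approx_le q (\<alpha> m) \<iota> \<and> approx_le q \<iota> (\<alpha> m)"
    using S.eventually_ge_hypernat_at_top[OF N(1)]
  proof eventually_elim
    case (elim m)
    then have m: "m \<in> hypernat \<sigma>" by (simp add: S.hypernat_ge_iff)
    obtain n where n: "n \<in> hypernat_ge \<sigma> m" "approx_le (q + 2) (\<alpha> m) (x n)"
      using tail_sup(3)[OF m] by blast
    \<comment> \<open>The term approximating \<open>\<alpha> m\<close> has an index beyond
      \<open>m\<close>, hence beyond \<open>N\<close>, so the upper estimate for the terms carries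
      over to every \<open>\<alpha> m\<close> with \<open>m\<close> beyond \<open>N\<close>.\<close>
    then have "n \<in> hypernat_ge \<sigma> N" using elim S.le_trans by (auto simp: S.hypernat_ge_iff)
    then have "approx_le q (\<alpha> m) \<iota>" using approx_le_trans n N by blast
    moreover have "approx_le q \<iota> (\<alpha> m)"
      using assms m by (intro le_imp_approx_le) (simp add: limsup_iff_inf_tail_sup tail_sup_inf_iff)
    ultimately show ?case by blast
  qed
qed

end

text \<open>A hyperlimit consists of two eventual estimates. Each is also frequent because the
  filter is proper, which supplies all four conditions; conversely the two eventual ones among the
  four suffice.\<close>

lemma hyperlim_iff_limsup_liminf:
  assumes "x \<in> hyperseqs \<sigma> \<rho>"
  shows "is_hyperlim \<sigma> \<rho> x l \<longleftrightarrow> is_limsup \<sigma> \<rho> x l \<and> is_liminf \<sigma> \<rho> x l"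
proof -
  have "(\<exists>\<^sub>F n in S.hypernat_at_top. P n)" if "\<forall>\<^sub>F n in S.hypernat_at_top. P n" for P
    using that S.hypernat_at_top_neq_bot by (simp add: eventually_frequently)
  then show ?thesis
    unfolding is_hyperlim_iff[OF assms] is_limsup_iff[OF assms] is_liminf_iff[OF assms]
      eventually_conj_iff
    by blast
qed

section \<open>Sums and products\<close>

lemma eventually_approx_add:
  assumes "is_limsup \<sigma> \<rho> x \<iota>" "is_limsup \<sigma> \<rho> y \<kappa>" "x \<in> hyperseqs \<sigma> \<rho>" "y \<in> hyperseqs \<sigma> \<rho>"
  shows "\<forall>\<^sub>F n in S.hypernat_at_top. approx_le q (x n \<oplus>\<^bsub>RC \<rho>\<^esub> y n) (\<iota> \<oplus>\<^bsub>RC \<rho>\<^esub> \<kappa>)"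
proof -
  have "\<forall>\<^sub>F n in S.hypernat_at_top. approx_le (q + 2) (x n) \<iota>"
    "\<forall>\<^sub>F n in S.hypernat_at_top. approx_le (q + 2) (y n) \<kappa>"
    using assms is_limsup_iff by blast+
  then show ?thesis by eventually_elim (rule approx_le_add)
qed

lemma limsup_add_le:
  assumes xy: "x \<in> hyperseqs \<sigma> \<rho>" "y \<in> hyperseqs \<sigma> \<rho>"
    and "is_limsup \<sigma> \<rho> x \<iota>" "is_limsup \<sigma> \<rho> y \<kappa>" "is_limsup \<sigma> \<rho> (\<lambda>n. x n \<oplus>\<^bsub>RC \<rho>\<^esub> y n) \<mu>"
  shows "rc_le \<rho> \<mu> (\<iota> \<oplus>\<^bsub>RC \<rho>\<^esub> \<kappa>)"
  using assms is_limsup_iff[OF hyperseqs_add[OF xy]]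
  by (intro le_if_frequently_eventually[of _ "\<lambda>n. x n \<oplus>\<^bsub>RC \<rho>\<^esub> y n"] eventually_approx_add) auto

lemma limsupD_frequently:
  assumes "is_limsup \<sigma> \<rho> x \<iota>" "x \<in> hyperseqs \<sigma> \<rho>" "N \<in> hypernat \<sigma>"
  obtains n where "n \<in> hypernat_ge \<sigma> N" "approx_le q \<iota> (x n)"
  using assms is_limsup_iff[OF assms(2)] unfolding S.frequently_hypernat_at_top by blast

text \<open>The two limits superior may be approached at different indices. The domination
  hypothesis replaces such a pair by a single index in the same tail, which gives the frequent lower
  estimate.\<close>

lemma limsup_add:
  assumes xy: "x \<in> hyperseqs \<sigma> \<rho>" "y \<in> hyperseqs \<sigma> \<rho>"
    and l: "is_limsup \<sigma> \<rho> x \<iota>" "is_limsup \<sigma> \<rho> y \<kappa>"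
    and dom: "\<forall>N\<in>hypernat \<sigma>. \<forall>n1\<in>hypernat_ge \<sigma> N. \<forall>n2\<in>hypernat_ge \<sigma> N. \<exists>n\<in>hypernat_ge \<sigma> N.
        rc_le \<rho> (x n1 \<oplus>\<^bsub>RC \<rho>\<^esub> y n2) (x n \<oplus>\<^bsub>RC \<rho>\<^esub> y n)"
  shows "is_limsup \<sigma> \<rho> (\<lambda>n. x n \<oplus>\<^bsub>RC \<rho>\<^esub> y n) (\<iota> \<oplus>\<^bsub>RC \<rho>\<^esub> \<kappa>)"
  unfolding is_limsup_iff[OF hyperseqs_add[OF xy]]
proof (intro conjI allI)
  show "\<iota> \<oplus>\<^bsub>RC \<rho>\<^esub> \<kappa> \<in> carrier (RC \<rho>)" using l[THEN limsup_carrierD] by simp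
  fix q
  show "\<forall>\<^sub>F n in S.hypernat_at_top. approx_le q (x n \<oplus>\<^bsub>RC \<rho>\<^esub> y n) (\<iota> \<oplus>\<^bsub>RC \<rho>\<^esub> \<kappa>)"
    by (rule eventually_approx_add[OF l xy])
  show "\<exists>\<^sub>F n in S.hypernat_at_top. approx_le q (\<iota> \<oplus>\<^bsub>RC \<rho>\<^esub> \<kappa>) (x n \<oplus>\<^bsub>RC \<rho>\<^esub> y n)"
    unfolding S.frequently_hypernat_at_top
  proof
    fix N assume N: "N \<in> hypernat \<sigma>"
    \<comment> \<open>Two powers are spent on adding the estimates and two on the passage to the
      common index.\<close>
    obtain n1 where n1: "n1 \<in> hypernat_ge \<sigma> N" "approx_le (q + 2 + 2) \<iota> (x n1)"
      using l(1) xy(1) N by (rule limsupD_frequently)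
    obtain n2 where n2: "n2 \<in> hypernat_ge \<sigma> N" "approx_le (q + 2 + 2) \<kappa> (y n2)"
      using l(2) xy(2) N by (rule limsupD_frequently)
    obtain n where "n \<in> hypernat_ge \<sigma> N" "rc_le \<rho> (x n1 \<oplus>\<^bsub>RC \<rho>\<^esub> y n2) (x n \<oplus>\<^bsub>RC \<rho>\<^esub> y n)"
      using dom N n1 n2 by blast
    moreover have "approx_le (q + 2) (\<iota> \<oplus>\<^bsub>RC \<rho>\<^esub> \<kappa>) (x n1 \<oplus>\<^bsub>RC \<rho>\<^esub> y n2)"
      using n1(2) n2(2) by (rule approx_le_add)
    ultimately show "\<exists>n\<in>hypernat_ge \<sigma> N. approx_le q (\<iota> \<oplus>\<^bsub>RC \<rho>\<^esub> \<kappa>) (x n \<oplus>\<^bsub>RC \<rho>\<^esub> y n)"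
      using approx_le_le_trans by blast
  qed
qed

text \<open>Supplies the sign of the limits that \<open>approx_le_mult\<close> requires.\<close>

lemma limsup_nonneg:
  assumes "x \<in> hyperseqs \<sigma> \<rho>" "is_limsup \<sigma> \<rho> x \<iota>" "\<And>n. n \<in> hypernat \<sigma> \<Longrightarrow> rc_le \<rho> \<zero>\<^bsub>RC \<rho>\<^esub> (x n)"
  shows "rc_le \<rho> \<zero>\<^bsub>RC \<rho>\<^esub> \<iota>"
proof (rule le_if_frequently_eventually[of _ x])
  fix q
  have "\<forall>\<^sub>F n in S.hypernat_at_top. approx_le q \<zero>\<^bsub>RC \<rho>\<^esub> (x n)"
    using S.eventually_hypernat by eventually_elim (intro le_imp_approx_le assms)
  then show "\<exists>\<^sub>F n in S.hypernat_at_top. approx_le q \<zero>\<^bsub>RC \<rho>\<^esub> (x n)"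
    using S.hypernat_at_top_neq_bot by (simp add: eventually_frequently)
  show "\<forall>\<^sub>F n in S.hypernat_at_top. approx_le q (x n) \<iota>" using assms is_limsup_iff by blast
qed

context
  fixes x y
  assumes xy: "x \<in> hyperseqs \<sigma> \<rho>" "y \<in> hyperseqs \<sigma> \<rho>"
    and nonneg: "\<And>n. n \<in> hypernat \<sigma> \<Longrightarrow> rc_le \<rho> \<zero>\<^bsub>RC \<rho>\<^esub> (x n)"
      "\<And>n. n \<in> hypernat \<sigma> \<Longrightarrow> rc_le \<rho> \<zero>\<^bsub>RC \<rho>\<^esub> (y n)"
begin

lemma eventually_approx_mult:
  assumes l: "is_limsup \<sigma> \<rho> x \<iota>" "is_limsup \<sigma> \<rho> y \<kappa>"
  shows "\<forall>\<^sub>F n in S.hypernat_at_top. approx_le q (x n \<otimes>\<^bsub>RC \<rho>\<^esub> y n) (\<iota> \<otimes>\<^bsub>RC \<rho>\<^esub> \<kappa>)"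
proof -
  have "rc_le \<rho> \<zero>\<^bsub>RC \<rho>\<^esub> \<iota>" "rc_le \<rho> \<zero>\<^bsub>RC \<rho>\<^esub> \<kappa>" using limsup_nonneg xy l nonneg by blast+
  then obtain M where M: "\<And>q X Y. rc_le \<rho> \<zero>\<^bsub>RC \<rho>\<^esub> X \<Longrightarrow> rc_le \<rho> \<zero>\<^bsub>RC \<rho>\<^esub> Y \<Longrightarrow>
      approx_le (q + M) X \<iota> \<Longrightarrow> approx_le (q + M) Y \<kappa> \<Longrightarrow>
      approx_le q (X \<otimes>\<^bsub>RC \<rho>\<^esub> Y) (\<iota> \<otimes>\<^bsub>RC \<rho>\<^esub> \<kappa>)"
    by (rule approx_le_mult) blast
  have "\<forall>\<^sub>F n in S.hypernat_at_top. approx_le (q + M) (x n) \<iota>"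
    "\<forall>\<^sub>F n in S.hypernat_at_top. approx_le (q + M) (y n) \<kappa>"
    using l xy is_limsup_iff by blast+
  with S.eventually_hypernat show ?thesis by eventually_elim (intro M nonneg)
qed

lemma limsup_mult_le:
  assumes "is_limsup \<sigma> \<rho> x \<iota>" "is_limsup \<sigma> \<rho> y \<kappa>" "is_limsup \<sigma> \<rho> (\<lambda>n. x n \<otimes>\<^bsub>RC \<rho>\<^esub> y n) \<mu>"
  shows "rc_le \<rho> \<mu> (\<iota> \<otimes>\<^bsub>RC \<rho>\<^esub> \<kappa>)"
  using assms is_limsup_iff[OF hyperseqs_mult[OF xy]]
  by (intro le_if_frequently_eventually[of _ "\<lambda>n. x n \<otimes>\<^bsub>RC \<rho>\<^esub> y n"] eventually_approx_mult) auto

lemma limsup_mult: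
  assumes l: "is_limsup \<sigma> \<rho> x \<iota>" "is_limsup \<sigma> \<rho> y \<kappa>"
    and dom: "\<forall>N\<in>hypernat \<sigma>. \<forall>n1\<in>hypernat_ge \<sigma> N. \<forall>n2\<in>hypernat_ge \<sigma> N. \<exists>n\<in>hypernat_ge \<sigma> N.
        rc_le \<rho> (x n1 \<otimes>\<^bsub>RC \<rho>\<^esub> y n2) (x n \<otimes>\<^bsub>RC \<rho>\<^esub> y n)"
  shows "is_limsup \<sigma> \<rho> (\<lambda>n. x n \<otimes>\<^bsub>RC \<rho>\<^esub> y n) (\<iota> \<otimes>\<^bsub>RC \<rho>\<^esub> \<kappa>)"
  unfolding is_limsup_iff[OF hyperseqs_mult[OF xy]]
proof (intro conjI allI)
  show "\<iota> \<otimes>\<^bsub>RC \<rho>\<^esub> \<kappa> \<in> carrier (RC \<rho>)" using l[THEN limsup_carrierD] by simp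
  fix q
  show "\<forall>\<^sub>F n in S.hypernat_at_top. approx_le q (x n \<otimes>\<^bsub>RC \<rho>\<^esub> y n) (\<iota> \<otimes>\<^bsub>RC \<rho>\<^esub> \<kappa>)"
    by (rule eventually_approx_mult[OF l])
  have "rc_le \<rho> \<zero>\<^bsub>RC \<rho>\<^esub> \<iota>" "rc_le \<rho> \<zero>\<^bsub>RC \<rho>\<^esub> \<kappa>" using limsup_nonneg xy l nonneg by blast+
  then obtain M where M: "\<And>q X Y. rc_le \<rho> \<zero>\<^bsub>RC \<rho>\<^esub> X \<Longrightarrow> rc_le \<rho> \<zero>\<^bsub>RC \<rho>\<^esub> Y \<Longrightarrow>
      approx_le (q + M) \<iota> X \<Longrightarrow> approx_le (q + M) \<kappa> Y \<Longrightarrow>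
      approx_le q (\<iota> \<otimes>\<^bsub>RC \<rho>\<^esub> \<kappa>) (X \<otimes>\<^bsub>RC \<rho>\<^esub> Y)"
    by (rule approx_le_mult) blast
  show "\<exists>\<^sub>F n in S.hypernat_at_top. approx_le q (\<iota> \<otimes>\<^bsub>RC \<rho>\<^esub> \<kappa>) (x n \<otimes>\<^bsub>RC \<rho>\<^esub> y n)"
    unfolding S.frequently_hypernat_at_top
  proof
    fix N assume N: "N \<in> hypernat \<sigma>"
    \<comment> \<open>The shift \<open>M\<close> belongs to the product and depends on the limits
      only, so it is available before the tail is chosen; the 2 pays for the common index.\<close>
    obtain n1 where n1: "n1 \<in> hypernat_ge \<sigma> N" "approx_le (q + 2 + M) \<iota> (x n1)"
      using l(1) xy(1) N by (rule limsupD_frequently)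
    obtain n2 where n2: "n2 \<in> hypernat_ge \<sigma> N" "approx_le (q + 2 + M) \<kappa> (y n2)"
      using l(2) xy(2) N by (rule limsupD_frequently)
    obtain n where "n \<in> hypernat_ge \<sigma> N" "rc_le \<rho> (x n1 \<otimes>\<^bsub>RC \<rho>\<^esub> y n2) (x n \<otimes>\<^bsub>RC \<rho>\<^esub> y n)"
      using dom N n1 n2 by blast
    moreover have "approx_le (q + 2) (\<iota> \<otimes>\<^bsub>RC \<rho>\<^esub> \<kappa>) (x n1 \<otimes>\<^bsub>RC \<rho>\<^esub> y n2)"
      by (rule M) (use n1 n2 nonneg in \<open>auto simp: S.hypernat_ge_iff\<close>)
    ultimately show "\<exists>n\<in>hypernat_ge \<sigma> N. approx_le q (\<iota> \<otimes>\<^bsub>RC \<rho>\<^esub> \<kappa>) (x n \<otimes>\<^bsub>RC \<rho>\<^esub> y n)"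
      using approx_le_le_trans by blast
  qed
qed

end

section \<open>Sequences of indices realizing the limit superior\<close>

lemma limsup_subsequence:
  assumes x: "x \<in> hyperseqs \<sigma> \<rho>" and l: "is_limsup \<sigma> \<rho> x \<iota>"
  shows "\<exists>k :: nat \<Rightarrow> gnum. (\<forall>q. k q \<in> hypernat \<sigma>) \<and> (\<forall>q. rc_less \<sigma> (k q) (k (Suc q))) \<and>
    tends_to_infinity \<sigma> k \<and> limitin (sharp_topology \<rho>) (\<lambda>q. x (k q)) \<iota> sequentially"
proof -
  have c: "\<iota> \<in> carrier (RC \<rho>)"
    and up: "\<And>q. \<forall>\<^sub>F n in S.hypernat_at_top. approx_le q (x n) \<iota>"
    and lo: "\<And>q. \<exists>\<^sub>F n in S.hypernat_at_top. approx_le q \<iota> (x n)"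
    using l is_limsup_iff[OF x] by auto
  \<comment> \<open>The requirements on the \<open>q\<close>-th index: approximation to order
    \<open>q\<close> from both sides, and size above all powers up to \<open>q\<close>. Both tighten
    with \<open>q\<close>, so convergence and divergence to infinity can be read off with
    \<open>Q\<close> equal to the given exponent.\<close>
  let ?P = "\<lambda>q n. n \<in> hypernat \<sigma> \<and> approx_le q \<iota> (x n) \<and> approx_le q (x n) \<iota> \<and>
    (\<forall>p\<le>q. rc_less \<sigma> (inv\<^bsub>RC \<sigma>\<^esub> (rc_d \<sigma> [^]\<^bsub>RC \<sigma>\<^esub> p)) n)"
  have step: "\<exists>n. ?P q n \<and> rc_less \<sigma> m n" if m: "m \<in> hypernat \<sigma>" for q m
  \<comment> \<open>\<open>K\<close> takes care of size, \<open>j\<close> lies strictly above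
    \<open>K\<close> and the previous index \<open>m\<close>, and both bounds are inherited by every
    index beyond \<open>j\<close>. Among these, the frequent and the eventual estimate meet.\<close>
  proof -
    obtain K where K: "K \<in> hypernat \<sigma>"
      "\<And>p. p \<le> q \<Longrightarrow> rc_less \<sigma> (inv\<^bsub>RC \<sigma>\<^esub> (rc_d \<sigma> [^]\<^bsub>RC \<sigma>\<^esub> p)) K"
      using S.hypernat_above_inv_rc_d_power by blast
    obtain j where j: "j \<in> hypernat \<sigma>" "rc_less \<sigma> m j" "rc_less \<sigma> K j"
      using S.hypernat_upper[OF m K(1)] by blast
    have "\<exists>\<^sub>F n in S.hypernat_at_top. approx_le q \<iota> (x n) \<and> approx_le q (x n) \<iota>"
      by (intro frequently_eventually_frequently up lo)
    then obtain n where n: "n \<in> hypernat_ge \<sigma> j" "approx_le q \<iota> (x n)" "approx_le q (x n) \<iota>"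
      using j(1) unfolding S.frequently_hypernat_at_top by blast
    have "rc_le \<sigma> K n" "rc_le \<sigma> j n"
      using n(1) S.le_trans[OF S.less_imp_le[OF j(3)]] by (auto simp: S.hypernat_ge_iff)
    with n j K show ?thesis
      using S.less_le_trans by (intro exI[of _ n]) (auto simp: S.hypernat_ge_iff)
  qed
  have "\<exists>k. \<forall>q. ?P q (k q) \<and> rc_less \<sigma> (k q) (k (Suc q))"
  proof (rule dependent_nat_choice)
    obtain m where "m \<in> hypernat \<sigma>" using S.hypernat_above_inv_rc_d_power by blast
    then show "\<exists>n. ?P 0 n" using step by blast
  qed (use step in blast)
  then obtain k where P: "\<And>q. ?P q (k q)" and inc: "\<And>q. rc_less \<sigma> (k q) (k (Suc q))" by blast
  have "tends_to_infinity \<sigma> k"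
    unfolding tends_to_infinity_def using P by blast
  moreover have "limitin (sharp_topology \<rho>) (\<lambda>q. x (k q)) \<iota> sequentially"
    unfolding limitin_sharp_iff[OF c] eventually_sequentially
    using P approx_le_antimono by blast
  ultimately show ?thesis using P inc by blast
qed

text \<open>A term far out is dominated by a term of the sequence that must itself lie far out,
  where it is close to \<iota>; this is the eventual estimate. The frequent one is witnessed by the
  sequence, since it reaches every tail.\<close>

lemma limsup_of_dominating_subsequence:
  assumes x: "x \<in> hyperseqs \<sigma> \<rho>" and c: "\<iota> \<in> carrier (RC \<rho>)"
    and k: "\<And>q. k q \<in> hypernat \<sigma>" and inc: "\<And>q. rc_less \<sigma> (k q) (k (Suc q))"
    and inf: "tends_to_infinity \<sigma> k"
    and lim: "limitin (sharp_topology \<rho>) (\<lambda>q. x (k q)) \<iota> sequentially"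
    and dom: "\<And>n. n \<in> hypernat \<sigma> \<Longrightarrow> \<exists>p. rc_le \<sigma> n (k p) \<and> rc_le \<rho> (x n) (x (k p))"
  shows "is_limsup \<sigma> \<rho> x \<iota>"
  unfolding is_limsup_iff[OF x]
proof (intro conjI allI c)
  have near: "\<exists>Q. \<forall>p\<ge>Q. approx_le q \<iota> (x (k p)) \<and> approx_le q (x (k p)) \<iota>" for q
    using lim unfolding limitin_sharp_iff[OF c] eventually_sequentially by blast
  fix q
  obtain Q where Q: "\<And>p. Q \<le> p \<Longrightarrow> approx_le (q + 2) (x (k p)) \<iota>"
    using near by blast
  have "approx_le q (x n) \<iota>" if n: "n \<in> hypernat_ge \<sigma> (k Q)" for n
  proof -
    obtain p where p: "rc_le \<sigma> n (k p)" "rc_le \<rho> (x n) (x (k p))"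
      using dom n by (auto simp: S.hypernat_ge_iff)
    have "rc_le \<sigma> (k Q) (k p)"
      using n p S.le_trans by (auto simp: S.hypernat_ge_iff)
    \<comment> \<open>Hypernaturals need not be comparable, but the positions \<open>p\<close> and
      \<open>Q\<close> are. If \<open>p < Q\<close>, then
      \<open>k (Suc p) \<le> k Q \<le> k p\<close>, against strict increase.\<close>
    have "Q \<le> p"
    proof (rule ccontr)
      assume "\<not> Q \<le> p"
      then have "rc_le \<sigma> (k (Suc p)) (k Q)"
        by (intro S.increasing_sequence_le k inc) simp
      then have "rc_less \<sigma> (k p) (k p)"
        using inc S.less_le_trans S.le_trans \<open>rc_le \<sigma> (k Q) (k p)\<close> by blast
      then show False using S.less_irrefl by blast
    qed
    then show ?thesis using le_approx_trans[OF p(2)] Q by blast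
  qed
  then show "\<forall>\<^sub>F n in S.hypernat_at_top. approx_le q (x n) \<iota>"
    unfolding S.eventually_hypernat_at_top using k by blast
  show "\<exists>\<^sub>F n in S.hypernat_at_top. approx_le q \<iota> (x n)"
    unfolding S.frequently_hypernat_at_top
  proof
    fix N assume N: "N \<in> hypernat \<sigma>"
    \<comment> \<open>Divergence to infinity refers to powers of the reciprocal gauge only, so
      \<open>N\<close> is first put below such a power.\<close>
    obtain r :: nat where r: "rc_le \<sigma> N (inv\<^bsub>RC \<sigma>\<^esub> (rc_d \<sigma> [^]\<^bsub>RC \<sigma>\<^esub> r))"
      using S.hypernat_le_inv_rc_d_power[OF N] by blast
    obtain Q1 where Q1: "\<And>p. Q1 \<le> p \<Longrightarrow> rc_less \<sigma> (inv\<^bsub>RC \<sigma>\<^esub> (rc_d \<sigma> [^]\<^bsub>RC \<sigma>\<^esub> r)) (k p)"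
      using inf unfolding tends_to_infinity_def by blast
    obtain Q2 where Q2: "\<And>p. Q2 \<le> p \<Longrightarrow> approx_le q \<iota> (x (k p))"
      using near by blast
    let ?p = "max Q1 Q2"
    have "k ?p \<in> hypernat_ge \<sigma> N"
      unfolding S.hypernat_ge_iff using k S.le_trans[OF r S.less_imp_le[OF Q1]] by simp
    moreover have "approx_le q \<iota> (x (k ?p))" by (rule Q2) simp
    ultimately show "\<exists>n\<in>hypernat_ge \<sigma> N. approx_le q \<iota> (x n)" by blast
  qed
qed

end

theorem theorem52:
  fixes \<rho> \<sigma> :: net and x y :: "gnum \<Rightarrow> gnum"
  assumes "gauge_net \<rho>" and "gauge_net \<sigma>"
    and "x \<in> hyperseqs \<sigma> \<rho>" and "y \<in> hyperseqs \<sigma> \<rho>"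
  shows
    \<comment> \<open>(i)\<close>
    "((\<exists>\<^sub>\<le>\<^sub>1\<iota>. is_limsup \<sigma> \<rho> x \<iota>) \<and> (\<exists>\<^sub>\<le>\<^sub>1\<tau>. is_liminf \<sigma> \<rho> x \<tau>)) \<and>
    \<comment> \<open>(ii)\<close>
    (\<forall>\<alpha>. (\<forall>m\<in>hypernat \<sigma>. is_sharp_sup \<rho> (x ` hypernat_ge \<sigma> m) (\<alpha> m)) \<longrightarrow>
      ((\<exists>\<iota>. is_limsup \<sigma> \<rho> x \<iota>) \<longleftrightarrow> (\<exists>a. is_sharp_inf \<rho> (\<alpha> ` hypernat \<sigma>) a)) \<and>
      (\<forall>\<iota> a. is_limsup \<sigma> \<rho> x \<iota> \<and> is_sharp_inf \<rho> (\<alpha> ` hypernat \<sigma>) a \<longrightarrow>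
        (\<exists>l. is_hyperlim \<sigma> \<rho> \<alpha> l \<and> \<iota> = l \<and> l = a))) \<and>
    \<comment> \<open>(iii)\<close>
    (((\<exists>\<iota>. is_limsup \<sigma> \<rho> (\<lambda>n. \<ominus>\<^bsub>RC \<rho>\<^esub> x n) \<iota>) \<longleftrightarrow> (\<exists>\<tau>. is_liminf \<sigma> \<rho> x \<tau>)) \<and>
      (\<forall>\<iota> \<tau>. is_limsup \<sigma> \<rho> (\<lambda>n. \<ominus>\<^bsub>RC \<rho>\<^esub> x n) \<iota> \<and> is_liminf \<sigma> \<rho> x \<tau> \<longrightarrow>
        \<iota> = \<ominus>\<^bsub>RC \<rho>\<^esub> \<tau>)) \<and>
    \<comment> \<open>(iv)\<close>
    ((\<exists>l. is_hyperlim \<sigma> \<rho> x l) \<longleftrightarrow>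
      (\<exists>\<iota> \<tau>. is_limsup \<sigma> \<rho> x \<iota> \<and> is_liminf \<sigma> \<rho> x \<tau> \<and> \<iota> = \<tau>)) \<and>
    \<comment> \<open>(v)\<close>
    (\<forall>\<iota> \<kappa> \<mu>. is_limsup \<sigma> \<rho> x \<iota> \<and> is_limsup \<sigma> \<rho> y \<kappa> \<and>
        is_limsup \<sigma> \<rho> (\<lambda>n. x n \<oplus>\<^bsub>RC \<rho>\<^esub> y n) \<mu> \<longrightarrow>
      rc_le \<rho> \<mu> (\<iota> \<oplus>\<^bsub>RC \<rho>\<^esub> \<kappa>)) \<and>
    ((\<forall>N\<in>hypernat \<sigma>. \<forall>n1\<in>hypernat_ge \<sigma> N. \<forall>n2\<in>hypernat_ge \<sigma> N. \<exists>n\<in>hypernat_ge \<sigma> N.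
        rc_le \<rho> (x n1 \<oplus>\<^bsub>RC \<rho>\<^esub> y n2) (x n \<oplus>\<^bsub>RC \<rho>\<^esub> y n)) \<longrightarrow>
      (\<exists>\<iota>. is_limsup \<sigma> \<rho> x \<iota>) \<and> (\<exists>\<kappa>. is_limsup \<sigma> \<rho> y \<kappa>) \<longrightarrow>
      (\<exists>\<mu>. is_limsup \<sigma> \<rho> (\<lambda>n. x n \<oplus>\<^bsub>RC \<rho>\<^esub> y n) \<mu>)) \<and>
    \<comment> \<open>(vi)\<close>
    ((\<forall>n\<in>hypernat \<sigma>. rc_le \<rho> \<zero>\<^bsub>RC \<rho>\<^esub> (x n) \<and> rc_le \<rho> \<zero>\<^bsub>RC \<rho>\<^esub> (y n)) \<longrightarrow>
      (\<forall>\<iota> \<kappa> \<mu>. is_limsup \<sigma> \<rho> x \<iota> \<and> is_limsup \<sigma> \<rho> y \<kappa> \<and>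
          is_limsup \<sigma> \<rho> (\<lambda>n. x n \<otimes>\<^bsub>RC \<rho>\<^esub> y n) \<mu> \<longrightarrow>
        rc_le \<rho> \<mu> (\<iota> \<otimes>\<^bsub>RC \<rho>\<^esub> \<kappa>)) \<and>
      ((\<forall>N\<in>hypernat \<sigma>. \<forall>n1\<in>hypernat_ge \<sigma> N. \<forall>n2\<in>hypernat_ge \<sigma> N. \<exists>n\<in>hypernat_ge \<sigma> N.
          rc_le \<rho> (x n1 \<otimes>\<^bsub>RC \<rho>\<^esub> y n2) (x n \<otimes>\<^bsub>RC \<rho>\<^esub> y n)) \<longrightarrow>
        (\<exists>\<iota>. is_limsup \<sigma> \<rho> x \<iota>) \<and> (\<exists>\<kappa>. is_limsup \<sigma> \<rho> y \<kappa>) \<longrightarrow>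
        (\<exists>\<mu>. is_limsup \<sigma> \<rho> (\<lambda>n. x n \<otimes>\<^bsub>RC \<rho>\<^esub> y n) \<mu>))) \<and>
    \<comment> \<open>(vii)\<close>
    (\<forall>\<iota>. is_limsup \<sigma> \<rho> x \<iota> \<longrightarrow>
      (\<exists>k :: nat \<Rightarrow> gnum. (\<forall>q. k q \<in> hypernat \<sigma>) \<and>
        (\<forall>q. rc_less \<sigma> (k q) (k (Suc q))) \<and>
        tends_to_infinity \<sigma> k \<and>
        limitin (sharp_topology \<rho>) (\<lambda>q. x (k q)) \<iota> sequentially)) \<and>
    \<comment> \<open>(viii)\<close>
    (\<forall>\<iota>\<in>carrier (RC \<rho>). \<forall>k :: nat \<Rightarrow> gnum. (\<forall>q. k q \<in> hypernat \<sigma>) \<and>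
        (\<forall>q. rc_less \<sigma> (k q) (k (Suc q))) \<and>
        tends_to_infinity \<sigma> k \<and>
        limitin (sharp_topology \<rho>) (\<lambda>q. x (k q)) \<iota> sequentially \<and>
        (\<forall>n\<in>hypernat \<sigma>. \<exists>p. rc_le \<sigma> n (k p) \<and> rc_le \<rho> (x n) (x (k p))) \<longrightarrow>
      is_limsup \<sigma> \<rho> x \<iota>)"
proof -
  interpret two_gauges \<rho> \<sigma> by unfold_locales (rule assms)+
  note x = assms(3) and y = assms(4)
  show ?thesis
  \<comment> \<open>Splitting yields eleven goals: uniqueness, negation and sums give two each,
    while statements headed by a quantifier or an implication stay whole.\<close>
  proof (intro conjI, goal_cases)
    case 1
    show ?case using limsup_unique[OF x] by (auto simp: Uniq_def)
  next
    case 2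
    show ?case using liminf_unique[OF x] by (auto simp: Uniq_def)
  next
    case 3
    show ?case
    proof (intro allI impI)
      fix \<alpha>
      assume "\<forall>m\<in>hypernat \<sigma>. is_sharp_sup \<rho> (x ` hypernat_ge \<sigma> m) (\<alpha> m)"
      then have \<alpha>: "\<And>m. m \<in> hypernat \<sigma> \<Longrightarrow> is_sharp_sup \<rho> (x ` hypernat_ge \<sigma> m) (\<alpha> m)" by blast
      \<comment> \<open>Read from right to left, the equivalence turns each sharp infimum into a
        limit superior. The existence claim becomes trivial and the equality becomes
        uniqueness.\<close>
      note inf = limsup_iff_inf_tail_sup[OF x \<alpha>, symmetric]
      have "\<exists>l. is_hyperlim \<sigma> \<rho> \<alpha> l \<and> \<iota> = l \<and> l = a"
        if "is_limsup \<sigma> \<rho> x \<iota>" "is_limsup \<sigma> \<rho> x a" for \<iota> a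
        using hyperlim_tail_sup[OF x \<alpha> that(1)] limsup_unique[OF x that] by blast
      then show "((\<exists>\<iota>. is_limsup \<sigma> \<rho> x \<iota>) \<longleftrightarrow> (\<exists>a. is_sharp_inf \<rho> (\<alpha> ` hypernat \<sigma>) a)) \<and>
        (\<forall>\<iota> a. is_limsup \<sigma> \<rho> x \<iota> \<and> is_sharp_inf \<rho> (\<alpha> ` hypernat \<sigma>) a \<longrightarrow>
          (\<exists>l. is_hyperlim \<sigma> \<rho> \<alpha> l \<and> \<iota> = l \<and> l = a))"
        by (simp only: inf) blast
    qed
  next
    case 4
    show ?case by (rule limsup_uminus_ex_iff[OF x])
  next
    case 5
    show ?case using limsup_uminus_eq[OF x] by blast
  next
    case 6
    show ?case using hyperlim_iff_limsup_liminf[OF x] by blast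
  next
    case 7
    show ?case using limsup_add_le[OF x y] by blast
  next
    case 8
    show ?case using limsup_add[OF x y] by blast
  next
    case 9
    show ?case
    proof (rule impI)
      assume "\<forall>n\<in>hypernat \<sigma>. rc_le \<rho> \<zero>\<^bsub>RC \<rho>\<^esub> (x n) \<and> rc_le \<rho> \<zero>\<^bsub>RC \<rho>\<^esub> (y n)"
      then have "\<And>n. n \<in> hypernat \<sigma> \<Longrightarrow> rc_le \<rho> \<zero>\<^bsub>RC \<rho>\<^esub> (x n)"
        "\<And>n. n \<in> hypernat \<sigma> \<Longrightarrow> rc_le \<rho> \<zero>\<^bsub>RC \<rho>\<^esub> (y n)" by blast+
      note le = limsup_mult_le[OF x y this] and ex = limsup_mult[OF x y this]
      show "(\<forall>\<iota> \<kappa> \<mu>. is_limsup \<sigma> \<rho> x \<iota> \<and> is_limsup \<sigma> \<rho> y \<kappa> \<and>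
          is_limsup \<sigma> \<rho> (\<lambda>n. x n \<otimes>\<^bsub>RC \<rho>\<^esub> y n) \<mu> \<longrightarrow>
        rc_le \<rho> \<mu> (\<iota> \<otimes>\<^bsub>RC \<rho>\<^esub> \<kappa>)) \<and>
      ((\<forall>N\<in>hypernat \<sigma>. \<forall>n1\<in>hypernat_ge \<sigma> N. \<forall>n2\<in>hypernat_ge \<sigma> N. \<exists>n\<in>hypernat_ge \<sigma> N.
          rc_le \<rho> (x n1 \<otimes>\<^bsub>RC \<rho>\<^esub> y n2) (x n \<otimes>\<^bsub>RC \<rho>\<^esub> y n)) \<longrightarrow>
        (\<exists>\<iota>. is_limsup \<sigma> \<rho> x \<iota>) \<and> (\<exists>\<kappa>. is_limsup \<sigma> \<rho> y \<kappa>) \<longrightarrow>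
        (\<exists>\<mu>. is_limsup \<sigma> \<rho> (\<lambda>n. x n \<otimes>\<^bsub>RC \<rho>\<^esub> y n) \<mu>))"
        using le ex by blast
    qed
  next
    case 10
    show ?case using limsup_subsequence[OF x] by blast
  next
    case 11
    show ?case
    proof (intro ballI allI impI, elim conjE)
      fix \<iota> and k :: "nat \<Rightarrow> gnum"
      assume "\<iota> \<in> carrier (RC \<rho>)" "\<forall>q. k q \<in> hypernat \<sigma>" "\<forall>q. rc_less \<sigma> (k q) (k (Suc q))"
        "tends_to_infinity \<sigma> k" "limitin (sharp_topology \<rho>) (\<lambda>q. x (k q)) \<iota> sequentially"
        "\<forall>n\<in>hypernat \<sigma>. \<exists>p. rc_le \<sigma> n (k p) \<and> rc_le \<rho> (x n) (x (k p))"
      then show "is_limsup \<sigma> \<rho> x \<iota>"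
        by (intro limsup_of_dominating_subsequence[OF x, of \<iota> k]) auto
    qed
  qed
qed

end
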